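(* Let $\Gamma=(\mathcal{P},\mathcal{L},* )$ be an imbrex geometry of symplectic rank $2$. If the symplecta of $\Gamma$ are thick generalized quadrangles, then every maximal singular subspace of $\Gamma$ contains a non-closing O'Nan configuration. In particular, no maximal singular subspace of $\Gamma$ is a projective space.
   Context: Point-line geometries: $\Gamma=(\mathcal{P},\mathcal{L},* )$ has point set $\mathcal{P}$ and line set $\mathcal{L}$, each line being identified with a subset of $\mathcal{P}$, and incidence $*$ is symmetrized containment. Two points are collinear if some line contains both (a point is collinear with itself); two lines are concurrent if they share at least one point. The incidence graph is the bipartite graph on $\mathcal{P}\cup\mathcal{L}$ with adjacency $*$. A subspace is a set $S\subseteq\mathcal{P}$ such that every line containing two distinct points of $S$ is contained in $S$; it is singular if any two of its points are collinear (the empty set and single points are allowed); it is convex if for any two of its points $x,y$ every point lying on, or incident with a line of, a shortest path from $x$ to $y$ in the incidence graph belongs to $S$. A polar space of rank $r$ is a point-line geometry such that: every line has at least $3$ points; no point is collinear with all other points; every nested sequence of (distinct) singular subspaces has length at most $r+1$ and one of length $r+1$ exists; for every point $x$ and line $L$, either exactly one or all points of $L$ are collinear with $x$. A polar space of rank $2$ is a generalized quadrangle; it is thick if every line contains at least $3$ points and every point is on at least $3$ lines. A strong parapolar space of diameter $2$ is a point-line geometry $\Gamma$ with: (PPS1) $\Gamma$ is connected (its incidence graph is connected), for every point $x$ and line $L$ either none, exactly one, or all points of $L$ are collinear with $x$, and all three possibilities occur; (PPS2) for every two non-collinear points $x,y$ the smallest convex subspace containing $x$ and $y$ (with the lines it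 contains) is a polar space of rank at least $2$. These convex subspaces are the symplecta (symps); $\xi(x,y)$ denotes the unique symp containing the non-collinear points $x,y$. An imbrex geometry is a strong parapolar space of diameter $2$ satisfying also: (PPS4) every nested sequence of singular subspaces has finite length; (Imb) if $x$ is a point not collinear with any point of a line $L$, and $y_1,y_2$ are distinct points of $L$, then $\xi(x,y_1)\cap\xi(x,y_2)$ is a singular subspace which is a maximal singular subspace of both $\xi(x,y_1)$ and $\xi(x,y_2)$. All symps of an imbrex geometry have the same rank, called its symplectic rank. A maximal singular subspace $B$ is viewed as a point-line geometry with the lines of $\Gamma$ contained in $B$. A non-closing O'Nan configuration is a set of four distinct lines such that exactly one pair of them is disjoint, while the other five pairs intersect in a point and these five intersection points are pairwise distinct. *)

theory Defs
  imports
    "Graph_Theory.Digraph_Component"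
    "Graph_Theory.Vertex_Walk"
begin

section \<open>Point-line geometries\<close>

record 'a geometry =
  points :: "'a set"
  lines :: "'a set set"

definition point_line_geometry :: "'a geometry \<Rightarrow> bool" where
  "point_line_geometry \<Gamma> \<longleftrightarrow> (\<forall>L\<in>lines \<Gamma>. L \<subseteq> points \<Gamma>)"

text \<open>The explicit equality makes a point on no line collinear with itself, too.\<close>

definition collinear :: "'a geometry \<Rightarrow> 'a \<Rightarrow> 'a \<Rightarrow> bool" where
  "collinear \<Gamma> x y \<longleftrightarrow> (x \<in> points \<Gamma> \<and> x = y) \<or> (\<exists>L\<in>lines \<Gamma>. x \<in> L \<and> y \<in> L)"

text \<open>The number of points on a line and of lines through a point may be infinite.\<close>

definition at_least_three :: "'b set \<Rightarrow> bool" where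
  "at_least_three A \<longleftrightarrow> infinite A \<or> 3 \<le> card A"

text \<open>An undirected edge is represented by its two opposite arcs.\<close>

definition incidence_graph :: "'a geometry \<Rightarrow> ('a + 'a set) pair_pre_digraph" where
  "incidence_graph \<Gamma> =
    \<lparr> pverts = Inl ` points \<Gamma> \<union> Inr ` lines \<Gamma>,
      parcs = {(Inl x, Inr L) | x L. x \<in> points \<Gamma> \<and> L \<in> lines \<Gamma> \<and> x \<in> L}
            \<union> {(Inr L, Inl x) | x L. x \<in> points \<Gamma> \<and> L \<in> lines \<Gamma> \<and> x \<in> L} \<rparr>"

definition shortest_path :: "'a geometry \<Rightarrow> 'a \<Rightarrow> 'a \<Rightarrow> ('a + 'a set) list \<Rightarrow> bool" where
  "shortest_path \<Gamma> x y p \<longleftrightarrow>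
    vpath p (with_proj (incidence_graph \<Gamma>)) \<and> hd p = Inl x \<and> last p = Inl y \<and>
    (\<forall>q. vpath q (with_proj (incidence_graph \<Gamma>)) \<and> hd q = Inl x \<and> last q = Inl y
         \<longrightarrow> vwalk_length p \<le> vwalk_length q)"

definition subspace :: "'a geometry \<Rightarrow> 'a set \<Rightarrow> bool" where
  "subspace \<Gamma> S \<longleftrightarrow> S \<subseteq> points \<Gamma> \<and>
    (\<forall>L\<in>lines \<Gamma>. (\<exists>x y. x \<in> L \<inter> S \<and> y \<in> L \<inter> S \<and> x \<noteq> y) \<longrightarrow> L \<subseteq> S)"

definition singular_subspace :: "'a geometry \<Rightarrow> 'a set \<Rightarrow> bool" where
  "singular_subspace \<Gamma> S \<longleftrightarrow> subspace \<Gamma> S \<and> (\<forall>x\<in>S. \<forall>y\<in>S. collinear \<Gamma> x y)"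

definition maximal_singular_subspace :: "'a geometry \<Rightarrow> 'a set \<Rightarrow> bool" where
  "maximal_singular_subspace \<Gamma> M \<longleftrightarrow>
    singular_subspace \<Gamma> M \<and> (\<forall>S. singular_subspace \<Gamma> S \<and> M \<subseteq> S \<longrightarrow> S = M)"

definition convex_subspace :: "'a geometry \<Rightarrow> 'a set \<Rightarrow> bool" where
  "convex_subspace \<Gamma> S \<longleftrightarrow> subspace \<Gamma> S \<and>
    (\<forall>x\<in>S. \<forall>y\<in>S. \<forall>p. shortest_path \<Gamma> x y p \<longrightarrow>
      (\<forall>z. Inl z \<in> set p \<longrightarrow> z \<in> S) \<and> (\<forall>L. Inr L \<in> set p \<longrightarrow> L \<subseteq> S))"

definition induced_geometry :: "'a geometry \<Rightarrow> 'a set \<Rightarrow> 'a geometry" where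
  "induced_geometry \<Gamma> S = \<lparr> points = S, lines = {L \<in> lines \<Gamma>. L \<subseteq> S} \<rparr>"


section \<open>Polar spaces and generalized quadrangles\<close>

text \<open>
  A nested sequence of distinct singular subspaces is a chain for inclusion, and its length is
  its number of members. The empty subspace counts, so in rank 2 a longest sequence consists of
  the empty set, a point and a line.
\<close>

definition polar_space :: "nat \<Rightarrow> 'a geometry \<Rightarrow> bool" where
  "polar_space r \<Gamma> \<longleftrightarrow>
    point_line_geometry \<Gamma> \<and>
    (\<forall>L\<in>lines \<Gamma>. at_least_three L) \<and>
    \<not> (\<exists>x\<in>points \<Gamma>. \<forall>y\<in>points \<Gamma> - {x}. collinear \<Gamma> x y) \<and>
    (\<forall>C. subset.chain {S. singular_subspace \<Gamma> S} C \<longrightarrow> finite C \<and> card C \<le> r + 1) \<and>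
    (\<exists>C. subset.chain {S. singular_subspace \<Gamma> S} C \<and> finite C \<and> card C = r + 1) \<and>
    (\<forall>x\<in>points \<Gamma>. \<forall>L\<in>lines \<Gamma>.
      (\<exists>!y. y \<in> L \<and> collinear \<Gamma> x y) \<or> (\<forall>y\<in>L. collinear \<Gamma> x y))"

definition generalized_quadrangle :: "'a geometry \<Rightarrow> bool" where
  "generalized_quadrangle \<Gamma> \<longleftrightarrow> polar_space 2 \<Gamma>"

definition thick_generalized_quadrangle :: "'a geometry \<Rightarrow> bool" where
  "thick_generalized_quadrangle \<Gamma> \<longleftrightarrow>
    generalized_quadrangle \<Gamma> \<and>
    (\<forall>L\<in>lines \<Gamma>. at_least_three L) \<and>
    (\<forall>x\<in>points \<Gamma>. at_least_three {L \<in> lines \<Gamma>. x \<in> L})"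


section \<open>Imbrex geometries\<close>

definition symp :: "'a geometry \<Rightarrow> 'a \<Rightarrow> 'a \<Rightarrow> 'a set" where
  "symp \<Gamma> x y = convex_subspace \<Gamma> hull {x, y}"

definition symps :: "'a geometry \<Rightarrow> 'a set set" where
  "symps \<Gamma> = {symp \<Gamma> x y | x y. x \<in> points \<Gamma> \<and> y \<in> points \<Gamma> \<and> \<not> collinear \<Gamma> x y}"

definition PPS1 :: "'a geometry \<Rightarrow> bool" where
  "PPS1 \<Gamma> \<longleftrightarrow>
    connected (with_proj (incidence_graph \<Gamma>)) \<and>
    (\<forall>x\<in>points \<Gamma>. \<forall>L\<in>lines \<Gamma>.
      (\<forall>y\<in>L. \<not> collinear \<Gamma> x y) \<or> (\<exists>!y. y \<in> L \<and> collinear \<Gamma> x y) \<or> (\<forall>y\<in>L. collinear \<Gamma> x y)) \<and>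
    (\<exists>x\<in>points \<Gamma>. \<exists>L\<in>lines \<Gamma>. \<forall>y\<in>L. \<not> collinear \<Gamma> x y) \<and>
    (\<exists>x\<in>points \<Gamma>. \<exists>L\<in>lines \<Gamma>. \<exists>!y. y \<in> L \<and> collinear \<Gamma> x y) \<and>
    (\<exists>x\<in>points \<Gamma>. \<exists>L\<in>lines \<Gamma>. \<forall>y\<in>L. collinear \<Gamma> x y)"

definition PPS2 :: "'a geometry \<Rightarrow> bool" where
  "PPS2 \<Gamma> \<longleftrightarrow>
    (\<forall>x\<in>points \<Gamma>. \<forall>y\<in>points \<Gamma>. \<not> collinear \<Gamma> x y \<longrightarrow>
      (\<exists>r\<ge>2. polar_space r (induced_geometry \<Gamma> (symp \<Gamma> x y))))"

definition strong_parapolar_space_diameter_2 :: "'a geometry \<Rightarrow> bool" where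
  "strong_parapolar_space_diameter_2 \<Gamma> \<longleftrightarrow> point_line_geometry \<Gamma> \<and> PPS1 \<Gamma> \<and> PPS2 \<Gamma>"

definition PPS4 :: "'a geometry \<Rightarrow> bool" where
  "PPS4 \<Gamma> \<longleftrightarrow> (\<forall>C. subset.chain {S. singular_subspace \<Gamma> S} C \<longrightarrow> finite C)"

definition Imb :: "'a geometry \<Rightarrow> bool" where
  "Imb \<Gamma> \<longleftrightarrow>
    (\<forall>x\<in>points \<Gamma>. \<forall>L\<in>lines \<Gamma>. (\<forall>y\<in>L. \<not> collinear \<Gamma> x y) \<longrightarrow>
      (\<forall>y1\<in>L. \<forall>y2\<in>L. y1 \<noteq> y2 \<longrightarrow>
        (let \<xi>1 = symp \<Gamma> x y1; \<xi>2 = symp \<Gamma> x y2 in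
          singular_subspace \<Gamma> (\<xi>1 \<inter> \<xi>2) \<and>
          maximal_singular_subspace (induced_geometry \<Gamma> \<xi>1) (\<xi>1 \<inter> \<xi>2) \<and>
          maximal_singular_subspace (induced_geometry \<Gamma> \<xi>2) (\<xi>1 \<inter> \<xi>2))))"

definition imbrex_geometry :: "'a geometry \<Rightarrow> bool" where
  "imbrex_geometry \<Gamma> \<longleftrightarrow> strong_parapolar_space_diameter_2 \<Gamma> \<and> PPS4 \<Gamma> \<and> Imb \<Gamma>"

text \<open>Not vacuous for imbrex geometries: \<open>PPS1\<close> provides non-collinear points, hence a symp.\<close>

definition has_symplectic_rank :: "'a geometry \<Rightarrow> nat \<Rightarrow> bool" where
  "has_symplectic_rank \<Gamma> r \<longleftrightarrow> (\<forall>\<xi>\<in>symps \<Gamma>. polar_space r (induced_geometry \<Gamma> \<xi>))"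


section \<open>O'Nan configurations and projective spaces\<close>

definition non_closing_ONan_configuration :: "'a geometry \<Rightarrow> 'a set set \<Rightarrow> bool" where
  "non_closing_ONan_configuration \<Gamma> Q \<longleftrightarrow>
    Q \<subseteq> lines \<Gamma> \<and>
    (\<exists>K L M N a b c d e.
      Q = {K, L, M, N} \<and> distinct [K, L, M, N] \<and>
      K \<inter> L = {} \<and>
      K \<inter> M = {a} \<and> K \<inter> N = {b} \<and> L \<inter> M = {c} \<and> L \<inter> N = {d} \<and> M \<inter> N = {e} \<and>
      distinct [a, b, c, d, e])"

text \<open>
  The Veblen--Young axioms. No lower bound on the dimension is imposed: the empty set, a point
  and a line with at least three points are projective spaces.
\<close>

definition projective_space :: "'a geometry \<Rightarrow> bool" where
  "projective_space \<Gamma> \<longleftrightarrow>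
    point_line_geometry \<Gamma> \<and>
    (\<forall>L\<in>lines \<Gamma>. at_least_three L) \<and>
    (\<forall>x\<in>points \<Gamma>. \<forall>y\<in>points \<Gamma>. x \<noteq> y \<longrightarrow> (\<exists>!L. L \<in> lines \<Gamma> \<and> x \<in> L \<and> y \<in> L)) \<and>
    (\<forall>a b c d AB CD AC BD.
      {a, b, c, d} \<subseteq> points \<Gamma> \<and> distinct [a, b, c, d] \<and>
      {AB, CD, AC, BD} \<subseteq> lines \<Gamma> \<and>
      {a, b} \<subseteq> AB \<and> {c, d} \<subseteq> CD \<and> {a, c} \<subseteq> AC \<and> {b, d} \<subseteq> BD \<and>
      AB \<inter> CD \<noteq> {} \<longrightarrow> AC \<inter> BD \<noteq> {})"

end

(* Call the maximal singular subspaces blocks. Two points of a block determine it, and (Imb) makes every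
   point outside a block B collinear with exactly one point of B, its foot. For disjoint blocks A and B,
   taking feet is an isomorphism from A onto B; every symplecton that meets a block meets it in a line, and
   no block is a line.

   Given B, choose a point y of B, further blocks A and D through y, a line L of A that avoids y and a
   symplecton containing L. It is disjoint from B and D, and taking feet in D partitions it into lines;
   L is the fibre over y. Let T and S be the fibres over two more points of a line of D through y. Every
   transversal of L and T has this line as its image in D, so it also meets S. Now take feet in B: L
   collapses to y, the images of T and S are disjoint lines off y, and two transversals of L, T and S
   become two lines through y that meet both. *)
theory Submission
  imports Defs
begin

section \<open>Polar spaces of rank 2\<close>

text \<open>The axioms of an imbrex geometry grant neither three points on a line nor a unique line
  through two points, and even an empty line has to be excluded. Quadrangles have these properties,
  so the first obstacle is to place every line inside a symplecton. Rank 2 then acts through the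
  absence of triangles in a quadrangle. Two projections of one symplecton are needed: the one onto
  \<open>D\<close> sends each of \<open>L\<close>, \<open>T\<close>, \<open>S\<close> to a point and
  so detects common transversals, whereas the one onto \<open>B\<close> collapses only
  \<open>L\<close>. The images of \<open>T\<close> and \<open>S\<close> in \<open>B\<close> are
  disjoint for this reason: if \<open>t\<close> in \<open>T\<close> and \<open>s\<close> in
  \<open>S\<close> had the same foot, the line through them would be both the fibre over that foot
  and the transversal through \<open>t\<close>. It would meet \<open>L\<close>, so the foot would be
  \<open>y\<close>; but only points of \<open>L\<close> have foot \<open>y\<close>.\<close>

lemma collinear_commute: "collinear G x y \<longleftrightarrow> collinear G y x"
  unfolding collinear_def by blast

lemma collinear_refl: "x \<in> points G \<Longrightarrow> collinear G x x"
  unfolding collinear_def by blast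

lemma collinear_line: "\<lbrakk>collinear G x y; x \<noteq> y\<rbrakk> \<Longrightarrow> \<exists>L\<in>lines G. x \<in> L \<and> y \<in> L"
  unfolding collinear_def by blast

lemma line_collinear: "\<lbrakk>L \<in> lines G; x \<in> L; y \<in> L\<rbrakk> \<Longrightarrow> collinear G x y"
  unfolding collinear_def by blast

lemma collinear_points:
  assumes "point_line_geometry G" "collinear G x y"
  shows "x \<in> points G" "y \<in> points G"
  using assms unfolding collinear_def point_line_geometry_def by blast+

lemma at_least_three_other:
  assumes "at_least_three A"
  shows "\<exists>z\<in>A. z \<noteq> x \<and> z \<noteq> y"
proof -
  have "\<not> A \<subseteq> {x, y}"
  proof
    assume "A \<subseteq> {x, y}"
    then have "finite A" "card A \<le> card {x, y}"
      by (auto intro: finite_subset card_mono)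
    moreover have "card {x, y} \<le> 2"
      by (cases "x = y") auto
    ultimately show False
      using assms unfolding at_least_three_def by auto
  qed
  then show ?thesis
    by blast
qed

text \<open>A common weakening of the point-line axiom of polar spaces and of the trichotomy in
  \<open>PPS1\<close>, so that facts on \<open>perp\<close> serve for symplecta and for the whole
  geometry.\<close>

definition one_or_all :: "'a geometry \<Rightarrow> bool" where
  "one_or_all G \<longleftrightarrow> (\<forall>x\<in>points G. \<forall>L\<in>lines G. \<forall>u\<in>L. \<forall>v\<in>L.
    u \<noteq> v \<longrightarrow> collinear G x u \<longrightarrow> collinear G x v \<longrightarrow> (\<forall>w\<in>L. collinear G x w))"

definition perp :: "'a geometry \<Rightarrow> 'a set \<Rightarrow> 'a set" where
  "perp G X = {z \<in> points G. \<forall>x\<in>X. collinear G z x}"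

lemma perp_antimono: "X \<subseteq> Y \<Longrightarrow> perp G Y \<subseteq> perp G X"
  unfolding perp_def by blast

lemma subspace_perp:
  assumes "point_line_geometry G" "one_or_all G" "X \<subseteq> points G"
  shows "subspace G (perp G X)"
proof -
  have "w \<in> perp G X" if "L \<in> lines G" "u \<in> L \<inter> perp G X" "v \<in> L \<inter> perp G X" "u \<noteq> v" "w \<in> L"
    for L u v w
  proof -
    have "w \<in> points G"
      using that assms(1) unfolding point_line_geometry_def by blast
    moreover have "collinear G w x" if "x \<in> X" for x
    proof -
      have "collinear G x u" "collinear G x v"
        using \<open>x \<in> X\<close> \<open>u \<in> L \<inter> perp G X\<close> \<open>v \<in> L \<inter> perp G X\<close> collinear_commute
        unfolding perp_def by fast+
      then show ?thesis
        using assms(2,3) \<open>x \<in> X\<close> \<open>L \<in> lines G\<close> \<open>u \<in> L \<inter> perp G X\<close> \<open>v \<in> L \<inter> perp G X\<close> \<open>u \<noteq> v\<close> \<open>w \<in> L\<close>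
          collinear_commute[of G w x] unfolding one_or_all_def by blast
    qed
    ultimately show ?thesis
      unfolding perp_def by blast
  qed
  moreover have "perp G X \<subseteq> points G"
    unfolding perp_def by blast
  ultimately show ?thesis
    unfolding subspace_def by (metis subsetI)
qed

text \<open>A clique \<open>X\<close> lies in its perp, so its double perp is contained in its perp
  and is thereby a clique itself. This replaces the generation of a span.\<close>

lemma singular_subspace_double_perp:
  assumes "point_line_geometry G" "one_or_all G" "X \<subseteq> points G"
    and clique: "\<And>x y. \<lbrakk>x \<in> X; y \<in> X\<rbrakk> \<Longrightarrow> collinear G x y"
  shows "singular_subspace G (perp G (perp G X))" and "X \<subseteq> perp G (perp G X)"
proof -
  let ?Y = "perp G X"
  have X: "X \<subseteq> ?Y"
    using assms unfolding perp_def by blast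
  show "X \<subseteq> perp G ?Y"
    using assms(3) collinear_commute unfolding perp_def by fast
  have "perp G ?Y \<subseteq> ?Y"
    using perp_antimono[OF X] .
  then have "collinear G u v" if "u \<in> perp G ?Y" "v \<in> perp G ?Y" for u v
    using that unfolding perp_def[of G ?Y] by blast
  moreover have "subspace G (perp G ?Y)"
    by (rule subspace_perp) (use assms in \<open>auto simp: perp_def\<close>)
  ultimately show "singular_subspace G (perp G ?Y)"
    unfolding singular_subspace_def by blast
qed

lemma polar_spaceD:
  assumes "polar_space r G"
  shows "point_line_geometry G" "\<And>L. L \<in> lines G \<Longrightarrow> at_least_three L"
    "\<And>x. x \<in> points G \<Longrightarrow> \<exists>y\<in>points G. \<not> collinear G x y"
    "\<And>x L. \<lbrakk>x \<in> points G; L \<in> lines G\<rbrakk> \<Longrightarrow>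
      (\<exists>!y. y \<in> L \<and> collinear G x y) \<or> (\<forall>y\<in>L. collinear G x y)"
proof -
  show "point_line_geometry G" "\<And>L. L \<in> lines G \<Longrightarrow> at_least_three L"
    "\<And>x L. \<lbrakk>x \<in> points G; L \<in> lines G\<rbrakk> \<Longrightarrow>
      (\<exists>!y. y \<in> L \<and> collinear G x y) \<or> (\<forall>y\<in>L. collinear G x y)"
    using assms by (simp_all add: polar_space_def)
  have "\<not> (\<exists>x\<in>points G. \<forall>y\<in>points G - {x}. collinear G x y)"
    using assms by (simp add: polar_space_def)
  then show "\<And>x. x \<in> points G \<Longrightarrow> \<exists>y\<in>points G. \<not> collinear G x y"
    by blast
qed

lemma polar_space_one_or_all:
  assumes "polar_space r G"
  shows "one_or_all G"
  unfolding one_or_all_def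
proof (intro ballI impI)
  fix x L u v w
  assume "x \<in> points G" "L \<in> lines G" "u \<in> L" "v \<in> L" "u \<noteq> v" "collinear G x u" "collinear G x v" "w \<in> L"
  then show "collinear G x w"
    using polar_spaceD(4)[OF assms \<open>x \<in> points G\<close> \<open>L \<in> lines G\<close>] by auto
qed

text \<open>The empty set, \<open>{p}\<close>, \<open>S\<close> and \<open>S'\<close> would form a
  chain of four members, one more than rank 2 permits.\<close>

lemma singular_subspace_not_nested:
  assumes "polar_space 2 G" "singular_subspace G S" "singular_subspace G S'" "S \<subseteq> S'"
    and "p \<in> S" "q \<in> S" "p \<noteq> q"
  shows "S = S'"
proof (rule ccontr)
  assume "S \<noteq> S'"
  let ?C = "{{}, {p}, S, S'}"
  have "p \<in> points G"
    using assms(2,5) unfolding singular_subspace_def subspace_def by blast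
  then have "singular_subspace G {p}" "singular_subspace G {}"
    unfolding singular_subspace_def subspace_def by (auto simp: collinear_refl)
  then have "subset.chain {S. singular_subspace G S} ?C"
    using assms(2-5) unfolding subset.chain_def by auto
  then have "card ?C \<le> 3"
    using assms(1) unfolding polar_space_def by fastforce
  moreover have "card ?C = 4"
  proof -
    have "{p} \<noteq> S" "{p} \<noteq> S'" "{} \<noteq> S" "{} \<noteq> S'"
      using assms(4-7) by blast+
    then show ?thesis
      using \<open>S \<noteq> S'\<close> by (simp add: card_insert_if)
  qed
  ultimately show False
    by simp
qed

text \<open>Another line might share two points with \<open>L\<close>, so closure of
  \<open>L\<close> is a genuine claim. It holds because the double perp of \<open>L\<close>, which
  is singular, turns out to be \<open>L\<close> itself.\<close>

lemma polar_space_2_line: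
  assumes G: "polar_space 2 G" and L: "L \<in> lines G"
  shows "singular_subspace G L"
proof -
  note plg = polar_spaceD(1)[OF G] and three = polar_spaceD(2)[OF G] and no_rad = polar_spaceD(3)[OF G]
  have one: "\<exists>y\<in>L. collinear G x y" if "x \<in> points G" "L \<in> lines G" for x L
    using polar_spaceD(4)[OF G that] at_least_three_other[OF three[OF that(2)]] by metis
  note oa = polar_space_one_or_all[OF G]
  define S where "S = perp G (perp G L)"
  have L_pts: "L \<subseteq> points G"
    using plg L unfolding point_line_geometry_def by blast
  have S: "singular_subspace G S" and LS: "L \<subseteq> S"
    unfolding S_def using singular_subspace_double_perp[OF plg oa L_pts] line_collinear[OF L] by blast+
  have S_pts: "S \<subseteq> points G" and S_sub: "subspace G S"
    using S unfolding singular_subspace_def subspace_def by blast+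
  have S_cl: "collinear G u v" if "u \<in> S" "v \<in> S" for u v
    using S that unfolding singular_subspace_def by blast
  obtain a where a: "a \<in> L"
    using at_least_three_other[OF three[OF L]] by metis
  obtain b where b: "b \<in> L" "b \<noteq> a"
    using at_least_three_other[OF three[OF L]] by metis
  \<comment> \<open>Two neighbours of \<open>w\<close> in \<open>S\<close> force
    \<open>perp G {w} \<inter> S\<close> to be all of \<open>S\<close> by the bound on chains; then
    \<open>insert w S\<close> is a clique whose double perp exceeds \<open>S\<close>, against the
    same bound.\<close>
  have unique: "u = v" if w: "w \<in> points G" "w \<notin> S" and "u \<in> S" "v \<in> S" "collinear G w u" "collinear G w v"
    for w u v
  proof (rule ccontr)
    assume "u \<noteq> v"
    have "subspace G (perp G {w})"
      using subspace_perp[OF plg oa] w by blast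
    then have "subspace G (perp G {w} \<inter> S)"
      using S_sub unfolding subspace_def by blast
    then have sing: "singular_subspace G (perp G {w} \<inter> S)"
      using S_cl unfolding singular_subspace_def by blast
    have "u \<in> perp G {w} \<inter> S" "v \<in> perp G {w} \<inter> S"
      using that S_pts collinear_commute unfolding perp_def by fast+
    then have "perp G {w} \<inter> S = S"
      using singular_subspace_not_nested[OF G sing S] \<open>u \<noteq> v\<close> by blast
    then have "\<And>s. s \<in> S \<Longrightarrow> collinear G s w"
      unfolding perp_def by blast
    then have cl: "collinear G s t" if "s \<in> insert w S" "t \<in> insert w S" for s t
      using that S_cl collinear_refl[OF w(1)] collinear_commute[of G] by blast
    have "insert w S \<subseteq> points G"
      using w S_pts by blast
    from singular_subspace_double_perp[OF plg oa this cl]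
    have "singular_subspace G (perp G (perp G (insert w S)))" "insert w S \<subseteq> perp G (perp G (insert w S))"
      by blast+
    then show False
      using singular_subspace_not_nested[OF G S] that \<open>u \<noteq> v\<close> by blast
  qed
  text \<open>Every point of \<open>S\<close> has a neighbour outside \<open>S\<close>; that neighbour is collinear with some point of
    each line of \<open>S\<close>, so all lines of \<open>S\<close> pass through every point of \<open>S\<close>.\<close>
  obtain w where w: "w \<in> points G" "\<not> collinear G a w"
    using no_rad L_pts a by blast
  then have "w \<notin> S"
    using S_cl a LS by blast
  obtain q where q: "q \<in> L" "collinear G w q"
    using one[OF w(1) L] by blast
  then have "w \<noteq> q"
    using \<open>w \<notin> S\<close> LS by blast
  then obtain M where M: "M \<in> lines G" "w \<in> M" "q \<in> M"
    using collinear_line q by metis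
  \<comment> \<open>The aim is a line \<open>N\<close> missing \<open>S\<close>. A point of
    \<open>S\<close> on \<open>N\<close> would be a neighbour of \<open>u\<close>, as
    \<open>q\<close> is, and hence equal to \<open>q\<close>; but \<open>w'\<close> is on
    \<open>N\<close> and not collinear with \<open>q\<close>.\<close>
  obtain w' where w': "w' \<in> points G" "\<not> collinear G q w'"
    using no_rad L_pts q by blast
  then have "w' \<notin> S"
    using S_cl q LS by blast
  obtain u where u: "u \<in> M" "collinear G w' u"
    using one[OF w'(1) M(1)] by blast
  have "u \<noteq> w'" "u \<noteq> q"
    using u w' M line_collinear collinear_commute by metis+
  have "u \<notin> S"
    using unique[OF w(1) \<open>w \<notin> S\<close>] q LS u M line_collinear \<open>u \<noteq> q\<close> by (metis subsetD)
  obtain N where N: "N \<in> lines G" "u \<in> N" "w' \<in> N"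
    using collinear_line u \<open>u \<noteq> w'\<close> by metis
  have "u \<in> points G"
    using plg M u unfolding point_line_geometry_def by blast
  have "s \<notin> N" if "s \<in> S" for s
  proof
    assume "s \<in> N"
    then have "collinear G u s" "collinear G w' s"
      using N line_collinear by metis+
    moreover have "collinear G u q"
      using u M line_collinear by metis
    ultimately show False
      using unique[OF \<open>u \<in> points G\<close> \<open>u \<notin> S\<close> that, of q] q LS w' collinear_commute by (metis subsetD)
  qed
  then have "z \<in> L" if "z \<in> S" for z
  proof -
    obtain v where v: "v \<in> N" "collinear G z v"
      using one[of z N] N S_pts \<open>z \<in> S\<close> by blast
    then have "v \<in> points G" "v \<notin> S"
      using N plg \<open>\<And>s. s \<in> S \<Longrightarrow> s \<notin> N\<close> unfolding point_line_geometry_def by blast+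
    moreover obtain s where "s \<in> L" "collinear G v s"
      using one[OF \<open>v \<in> points G\<close> L] by blast
    ultimately show ?thesis
      using unique[of v z s] v collinear_commute \<open>z \<in> S\<close> LS by (metis subsetD)
  qed
  then show ?thesis
    using S LS by (metis subsetI subset_antisym)
qed

text \<open>If \<open>p\<close> were collinear with all of \<open>L\<close>, the double perp of the
  clique \<open>insert p L\<close> would be a singular subspace properly containing
  \<open>L\<close>. In other words, quadrangles have no triangles.\<close>

lemma polar_space_2_unique_neighbour:
  assumes G: "polar_space 2 G" and L: "L \<in> lines G" and p: "p \<in> points G" "p \<notin> L"
  shows "\<exists>!q. q \<in> L \<and> collinear G p q"
proof (rule ccontr)
  assume "\<not> ?thesis"
  then have all: "\<forall>y\<in>L. collinear G p y"
    using polar_spaceD(4)[OF G p(1) L] by blast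
  note plg = polar_spaceD(1)[OF G] and three = polar_spaceD(2)[OF G L]
  note oa = polar_space_one_or_all[OF G]
  obtain a where a: "a \<in> L"
    using at_least_three_other[OF three] by metis
  obtain b where b: "b \<in> L" "b \<noteq> a"
    using at_least_three_other[OF three] by metis
  have pts: "insert p L \<subseteq> points G"
    using plg L p unfolding point_line_geometry_def by blast
  have cl: "collinear G s t" if "s \<in> insert p L" "t \<in> insert p L" for s t
    using that all collinear_refl[OF p(1)] line_collinear[OF L] collinear_commute[of G] by blast
  show False
    using singular_subspace_not_nested[OF G polar_space_2_line[OF G L], of _ a b] p a b
      singular_subspace_double_perp[OF plg oa pts cl] by blast
qed

section \<open>Convex subspaces\<close>

lemma collinear_induced_geometry:
  assumes "subspace G S" "x \<in> S" "y \<in> S"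
  shows "collinear (induced_geometry G S) x y \<longleftrightarrow> collinear G x y"
proof
  assume "collinear (induced_geometry G S) x y"
  then show "collinear G x y"
    using assms unfolding collinear_def induced_geometry_def subspace_def by auto
next
  assume col: "collinear G x y"
  show "collinear (induced_geometry G S) x y"
  proof (cases "x = y")
    case True
    then show ?thesis
      using assms unfolding collinear_def induced_geometry_def by auto
  next
    case False
    then obtain L where "L \<in> lines G" "x \<in> L" "y \<in> L"
      using collinear_line[OF col] by blast
    moreover from this have "L \<subseteq> S"
      using assms False unfolding subspace_def by blast
    ultimately show ?thesis
      unfolding collinear_def induced_geometry_def by auto
  qed
qed

lemma convex_subspace_Inter:
  assumes "\<S> \<noteq> {}" "\<And>S. S \<in> \<S> \<Longrightarrow> convex_subspace G S"
  shows "convex_subspace G (\<Inter>\<S>)"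
proof -
  have "subspace G S" if "S \<in> \<S>" for S
    using assms(2)[OF that] unfolding convex_subspace_def by blast
  then have "subspace G (\<Inter>\<S>)"
    using assms(1) unfolding subspace_def by blast
  moreover have "(\<forall>z. Inl z \<in> set p \<longrightarrow> z \<in> \<Inter>\<S>) \<and> (\<forall>L. Inr L \<in> set p \<longrightarrow> L \<subseteq> \<Inter>\<S>)"
    if "x \<in> \<Inter>\<S>" "y \<in> \<Inter>\<S>" "shortest_path G x y p" for x y p
    using assms(2) that unfolding convex_subspace_def by blast
  ultimately show ?thesis
    unfolding convex_subspace_def by blast
qed

text \<open>Ensures that the hull in \<open>symp\<close> intersects a nonempty family; the empty
  intersection would be the whole type.\<close>

lemma convex_subspace_points:
  assumes "point_line_geometry G"
  shows "convex_subspace G (points G)"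
proof -
  have "set p \<subseteq> Inl ` points G \<union> Inr ` lines G" if "shortest_path G x y p" for x y p
    using that unfolding shortest_path_def vpath_def vwalk_def by (simp add: incidence_graph_def)
  then show ?thesis
    using assms unfolding convex_subspace_def subspace_def point_line_geometry_def by blast
qed

lemma convex_subspace_symp:
  assumes "point_line_geometry G" "x \<in> points G" "y \<in> points G"
  shows "convex_subspace G (symp G x y)" and "x \<in> symp G x y" and "y \<in> symp G x y"
proof -
  show "convex_subspace G (symp G x y)"
    unfolding symp_def hull_def
    by (rule convex_subspace_Inter) (use assms convex_subspace_points in blast)+
  show "x \<in> symp G x y" "y \<in> symp G x y"
    unfolding symp_def hull_def by blast+
qed

lemma incidence_graph_arc:
  "(u, v) \<in> parcs (incidence_graph G) \<longleftrightarrow>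
    (\<exists>x L. x \<in> points G \<and> L \<in> lines G \<and> x \<in> L \<and> (u = Inl x \<and> v = Inr L \<or> u = Inr L \<and> v = Inl x))"
  by (auto simp: incidence_graph_def)

text \<open>A path is a list of vertices, so four arcs mean five entries. One entry gives
  \<open>x = y\<close>, two or four break the alternation of points and lines, and three put
  \<open>x\<close> and \<open>y\<close> on a common line.\<close>

lemma shortest_path_via_point:
  assumes "x \<in> points G" "y \<in> points G" "w \<in> points G" "\<not> collinear G x y"
    and "L \<in> lines G" "x \<in> L" "w \<in> L" "M \<in> lines G" "w \<in> M" "y \<in> M"
  shows "shortest_path G x y [Inl x, Inr L, Inl w, Inr M, Inl y]" (is "shortest_path G x y ?p")
proof -
  let ?I = "with_proj (incidence_graph G)"
  have "x \<noteq> y"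
    using assms collinear_refl by metis
  moreover have "x \<noteq> w" "w \<noteq> y" "L \<noteq> M"
    using assms line_collinear by metis+
  ultimately have "distinct ?p"
    by auto
  moreover have "vwalk ?p ?I"
    by (rule vwalkI) (use assms in \<open>auto simp: incidence_graph_arc incidence_graph_def\<close>)
  ultimately have "vpath ?p ?I"
    by blast
  moreover have "4 \<le> vwalk_length q" if q: "vpath q ?I" "hd q = Inl x" "last q = Inl y" for q
  proof (rule ccontr)
    assume "\<not> 4 \<le> vwalk_length q"
    then have "length q < 5"
      by simp
    moreover have "length q \<noteq> 0"
      using q unfolding vpath_def vwalk_def by simp
    ultimately have "length q = 1 \<or> length q = 2 \<or> length q = 3 \<or> length q = 4"
      by arith
    then consider a where "q = [a]" | a b where "q = [a, b]" | a b c where "q = [a, b, c]"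
      | a b c d where "q = [a, b, c, d]"
      by (auto simp: numeral_eq_Suc length_Suc_conv)
    then show False
    proof cases
      case 1
      then show ?thesis
        using q \<open>x \<noteq> y\<close> by simp
    next
      case 2
      then have "(Inl x, Inl y) \<in> parcs (incidence_graph G)"
        using q unfolding vpath_def vwalk_def by simp
      then show ?thesis
        by (simp add: incidence_graph_arc)
    next
      case (3 a b c)
      then have "(Inl x, b) \<in> parcs (incidence_graph G)" "(b, Inl y) \<in> parcs (incidence_graph G)"
        using q unfolding vpath_def vwalk_def by simp_all
      then show ?thesis
        using \<open>\<not> collinear G x y\<close> unfolding incidence_graph_arc collinear_def by auto
    next
      case (4 a b c d)
      then have "(Inl x, b) \<in> parcs (incidence_graph G)" "(b, c) \<in> parcs (incidence_graph G)"
        "(c, Inl y) \<in> parcs (incidence_graph G)"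
        using q unfolding vpath_def vwalk_def by simp_all
      then show ?thesis
        unfolding incidence_graph_arc by auto
    qed
  qed
  ultimately show ?thesis
    unfolding shortest_path_def by (simp add: numeral_eq_Suc)
qed

text \<open>Unless it is an end point, \<open>w\<close> is the middle of a shortest path from
  \<open>x\<close> to \<open>y\<close>. Later arguments use convexity only in this form.\<close>

lemma convex_subspace_common_neighbour:
  assumes "point_line_geometry G" "convex_subspace G S" "x \<in> S" "y \<in> S" "\<not> collinear G x y"
    and "collinear G w x" "collinear G w y"
  shows "w \<in> S"
proof (cases "w = x \<or> w = y")
  case False
  obtain L M where "L \<in> lines G" "x \<in> L" "w \<in> L" "M \<in> lines G" "w \<in> M" "y \<in> M"
    using collinear_line[OF assms(6)] collinear_line[OF assms(7)] False by blast
  then have "shortest_path G x y [Inl x, Inr L, Inl w, Inr M, Inl y]"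
    using shortest_path_via_point collinear_points[OF assms(1) assms(6)] collinear_points[OF assms(1) assms(7)]
      assms(5) by metis
  then show ?thesis
    using assms(2-4) unfolding convex_subspace_def by (metis list.set_intros)
qed (use assms in blast)

section \<open>Imbrex geometries with thick quadrangles as symplecta\<close>

locale thick_imbrex =
  fixes \<Gamma> :: "'a geometry"
  assumes imbrex: "imbrex_geometry \<Gamma>"
    and thick: "\<And>\<xi>. \<xi> \<in> symps \<Gamma> \<Longrightarrow> thick_generalized_quadrangle (induced_geometry \<Gamma> \<xi>)"
begin

abbreviation P :: "'a set" where "P \<equiv> points \<Gamma>"

abbreviation adj :: "'a \<Rightarrow> 'a \<Rightarrow> bool" (infix "\<sim>" 50) where "x \<sim> y \<equiv> collinear \<Gamma> x y"

lemma plg: "point_line_geometry \<Gamma>"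
  using imbrex unfolding imbrex_geometry_def strong_parapolar_space_diameter_2_def by blast

lemma PPS1: "PPS1 \<Gamma>"
  using imbrex unfolding imbrex_geometry_def strong_parapolar_space_diameter_2_def by blast

lemma line_points: "L \<in> lines \<Gamma> \<Longrightarrow> L \<subseteq> P"
  using plg unfolding point_line_geometry_def by blast

lemma adj_sym: "x \<sim> y \<Longrightarrow> y \<sim> x"
  using collinear_commute by metis

lemma adj_points: "x \<sim> y \<Longrightarrow> x \<in> P" "x \<sim> y \<Longrightarrow> y \<in> P"
  using collinear_points[OF plg] by blast+

lemma adj_refl: "x \<in> P \<Longrightarrow> x \<sim> x"
  by (rule collinear_refl)

lemma one_or_all: "one_or_all \<Gamma>"
  unfolding one_or_all_def
proof (intro ballI impI)
  fix x L u v w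
  assume *: "x \<in> P" "L \<in> lines \<Gamma>" "u \<in> L" "v \<in> L" "u \<noteq> v" "x \<sim> u" "x \<sim> v" "w \<in> L"
  have "(\<forall>y\<in>L. \<not> x \<sim> y) \<or> (\<exists>!y. y \<in> L \<and> x \<sim> y) \<or> (\<forall>y\<in>L. x \<sim> y)"
    using PPS1 *(1,2) unfolding PPS1_def by (elim conjE) simp
  then show "x \<sim> w"
    using * by blast
qed

lemma symp_convex:
  assumes "\<xi> \<in> symps \<Gamma>"
  shows "convex_subspace \<Gamma> \<xi>" and "subspace \<Gamma> \<xi>" and "\<xi> \<subseteq> P"
proof -
  show "convex_subspace \<Gamma> \<xi>"
    using assms convex_subspace_symp(1)[OF plg] unfolding symps_def by blast
  then show "subspace \<Gamma> \<xi>"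
    unfolding convex_subspace_def by blast
  then show "\<xi> \<subseteq> P"
    unfolding subspace_def by blast
qed

lemma symp_polar_space: "\<xi> \<in> symps \<Gamma> \<Longrightarrow> polar_space 2 (induced_geometry \<Gamma> \<xi>)"
  using thick unfolding thick_generalized_quadrangle_def generalized_quadrangle_def by blast

lemma ex_symp:
  assumes "x \<in> P" "y \<in> P" "\<not> x \<sim> y"
  shows "symp \<Gamma> x y \<in> symps \<Gamma>" and "x \<in> symp \<Gamma> x y" and "y \<in> symp \<Gamma> x y"
proof -
  show "symp \<Gamma> x y \<in> symps \<Gamma>"
    using assms unfolding symps_def by blast
  show "x \<in> symp \<Gamma> x y" "y \<in> symp \<Gamma> x y"
    using convex_subspace_symp[OF plg assms(1,2)] by blast+
qed

lemma induced_line: "L \<in> lines (induced_geometry \<Gamma> \<xi>) \<longleftrightarrow> L \<in> lines \<Gamma> \<and> L \<subseteq> \<xi>"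
  unfolding induced_geometry_def by simp

lemma induced_points: "points (induced_geometry \<Gamma> \<xi>) = \<xi>"
  unfolding induced_geometry_def by simp

lemma symp_line_at_least_three:
  assumes "\<xi> \<in> symps \<Gamma>" "L \<in> lines \<Gamma>" "L \<subseteq> \<xi>"
  shows "at_least_three L"
  using polar_spaceD(2)[OF symp_polar_space[OF assms(1)]] assms(2,3) by (simp add: induced_line)

lemma symp_not_adj:
  assumes "\<xi> \<in> symps \<Gamma>" "p \<in> \<xi>"
  shows "\<exists>q\<in>\<xi>. \<not> p \<sim> q"
  using polar_spaceD(3)[OF symp_polar_space[OF assms(1)], of p] assms
    collinear_induced_geometry[OF symp_convex(2)[OF assms(1)] assms(2)] by (auto simp: induced_points)

lemma symp_unique_neighbour:
  assumes "\<xi> \<in> symps \<Gamma>" "L \<in> lines \<Gamma>" "L \<subseteq> \<xi>" "p \<in> \<xi>" "p \<notin> L"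
  shows "\<exists>!q. q \<in> L \<and> p \<sim> q"
proof -
  have "\<exists>!q. q \<in> L \<and> collinear (induced_geometry \<Gamma> \<xi>) p q"
    using polar_space_2_unique_neighbour[OF symp_polar_space[OF assms(1)]] assms(2-5)
    by (simp add: induced_line induced_points)
  moreover have "collinear (induced_geometry \<Gamma> \<xi>) p q \<longleftrightarrow> p \<sim> q" if "q \<in> L" for q
    using collinear_induced_geometry[OF symp_convex(2)[OF assms(1)]] assms(3,4) that by blast
  ultimately show ?thesis
    by blast
qed

lemma symp_neighbour:
  assumes "\<xi> \<in> symps \<Gamma>" "L \<in> lines \<Gamma>" "L \<subseteq> \<xi>" "p \<in> \<xi>"
  shows "\<exists>q\<in>L. p \<sim> q"
proof (cases "p \<in> L")
  case True
  then show ?thesis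
    using adj_refl symp_convex(3)[OF assms(1)] assms(4) by blast
next
  case False
  then show ?thesis
    using symp_unique_neighbour[OF assms] by blast
qed

lemma symp_two_neighbours:
  assumes "\<xi> \<in> symps \<Gamma>" "L \<in> lines \<Gamma>" "L \<subseteq> \<xi>" "p \<in> \<xi>" "x \<in> L" "y \<in> L" "x \<noteq> y" "p \<sim> x" "p \<sim> y"
  shows "p \<in> L"
  using symp_unique_neighbour[OF assms(1-4)] assms(5-) by blast

lemma symp_lines_at_least_three:
  assumes "\<xi> \<in> symps \<Gamma>" "p \<in> \<xi>"
  shows "at_least_three {L \<in> lines \<Gamma>. L \<subseteq> \<xi> \<and> p \<in> L}"
proof -
  have "\<forall>x\<in>points (induced_geometry \<Gamma> \<xi>). at_least_three {L \<in> lines (induced_geometry \<Gamma> \<xi>). x \<in> L}"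
    using thick[OF assms(1)] unfolding thick_generalized_quadrangle_def by blast
  then show ?thesis
    using assms(2) by (simp add: induced_line induced_points conj_assoc)
qed

lemma symp_common_neighbour:
  "\<lbrakk>\<xi> \<in> symps \<Gamma>; x \<in> \<xi>; y \<in> \<xi>; \<not> x \<sim> y; w \<sim> x; w \<sim> y\<rbrakk> \<Longrightarrow> w \<in> \<xi>"
  using convex_subspace_common_neighbour[OF plg symp_convex(1)] by blast

lemma symp_line: "\<lbrakk>\<xi> \<in> symps \<Gamma>; L \<in> lines \<Gamma>; x \<in> L; y \<in> L; x \<noteq> y; x \<in> \<xi>; y \<in> \<xi>\<rbrakk> \<Longrightarrow> L \<subseteq> \<xi>"
  using symp_convex(2)[of \<xi>] unfolding subspace_def by blast

section \<open>Embedding lines in symplecta\<close>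

lemma ex_far_line: "\<exists>x\<in>P. \<exists>L\<in>lines \<Gamma>. \<forall>y\<in>L. \<not> x \<sim> y"
  using PPS1 unfolding PPS1_def by (elim conjE) simp

text \<open>An empty line would be an isolated vertex of the connected incidence graph. It has to be
  excluded because it would satisfy the condition on a far line in \<open>PPS1\<close>
  vacuously.\<close>

lemma line_nonempty:
  assumes "L \<in> lines \<Gamma>"
  shows "L \<noteq> {}"
proof
  assume "L = {}"
  let ?I = "mk_symmetric (with_proj (incidence_graph \<Gamma>))"
  obtain x where "x \<in> P"
    using ex_far_line by blast
  moreover have "connected (with_proj (incidence_graph \<Gamma>))"
    using PPS1 unfolding PPS1_def by (elim conjE) simp
  ultimately have "Inr {} \<rightarrow>\<^sup>*\<^bsub>with_proj ?I\<^esub> Inl x"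
    using assms \<open>L = {}\<close> unfolding connected_def strongly_connected_def
    by (simp add: mk_symmetric_def incidence_graph_def)
  then show False
  proof (cases rule: pre_digraph.converse_reachable_cases[consumes 1, case_names base step])
    case (step w)
    then show ?thesis
      by (auto simp: mk_symmetric_def incidence_graph_def arcs_ends_def arc_to_ends_def)
  qed simp
qed

text \<open>A point collinear with everything is a common neighbour of any non-collinear pair, hence
  lies in the symplecton of that pair, and there it has a non-neighbour.\<close>

lemma no_radical:
  assumes "p \<in> P"
  shows "\<exists>q\<in>P. \<not> p \<sim> q"
proof (rule ccontr)
  assume *: "\<not> ?thesis"
  obtain x L where "x \<in> P" "L \<in> lines \<Gamma>" and far: "\<And>y. y \<in> L \<Longrightarrow> \<not> x \<sim> y"
    using ex_far_line by metis
  then obtain y where "y \<in> L" "y \<in> P" "\<not> x \<sim> y"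
    using line_nonempty line_points by blast
  note \<xi> = ex_symp[OF \<open>x \<in> P\<close> \<open>y \<in> P\<close> \<open>\<not> x \<sim> y\<close>]
  have "p \<in> symp \<Gamma> x y"
    using symp_common_neighbour[OF \<xi> \<open>\<not> x \<sim> y\<close>] * \<open>x \<in> P\<close> \<open>y \<in> P\<close> by blast
  then show False
    using symp_not_adj[OF \<xi>(1)] symp_convex(3)[OF \<xi>(1)] * by blast
qed

lemma Imb:
  assumes "x \<in> P" "L \<in> lines \<Gamma>" "\<And>y. y \<in> L \<Longrightarrow> \<not> x \<sim> y" "y1 \<in> L" "y2 \<in> L" "y1 \<noteq> y2"
  shows "singular_subspace \<Gamma> (symp \<Gamma> x y1 \<inter> symp \<Gamma> x y2)"
    and "maximal_singular_subspace (induced_geometry \<Gamma> (symp \<Gamma> x y1)) (symp \<Gamma> x y1 \<inter> symp \<Gamma> x y2)"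
proof -
  have "Imb \<Gamma>"
    using imbrex unfolding imbrex_geometry_def by blast
  then show "singular_subspace \<Gamma> (symp \<Gamma> x y1 \<inter> symp \<Gamma> x y2)"
    and "maximal_singular_subspace (induced_geometry \<Gamma> (symp \<Gamma> x y1)) (symp \<Gamma> x y1 \<inter> symp \<Gamma> x y2)"
    unfolding Imb_def Let_def using assms by metis+
qed

lemma symp_ex_line:
  assumes "\<xi> \<in> symps \<Gamma>" "p \<in> \<xi>"
  shows "\<exists>L\<in>lines \<Gamma>. L \<subseteq> \<xi> \<and> p \<in> L"
  using at_least_three_other[OF symp_lines_at_least_three[OF assms]] by blast

text \<open>On two lines through \<open>x\<close> there are neighbours \<open>u\<close> and
  \<open>v\<close> of \<open>y\<close>; if these were collinear, the quadrangle would contain a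
  triangle or the two lines would coincide.\<close>

lemma symp_common_neighbours_not_clique:
  assumes \<xi>: "\<xi> \<in> symps \<Gamma>" and "x \<in> \<xi>" "y \<in> \<xi>" "\<not> x \<sim> y"
  shows "\<exists>u v. u \<sim> x \<and> u \<sim> y \<and> v \<sim> x \<and> v \<sim> y \<and> \<not> u \<sim> v"
proof -
  obtain K where K: "K \<in> lines \<Gamma>" "K \<subseteq> \<xi>" "x \<in> K"
    using symp_ex_line[OF \<xi> \<open>x \<in> \<xi>\<close>] by blast
  obtain M where M: "M \<in> lines \<Gamma>" "M \<subseteq> \<xi>" "x \<in> M" "M \<noteq> K"
    using at_least_three_other[OF symp_lines_at_least_three[OF \<xi> \<open>x \<in> \<xi>\<close>], of K K] by blast
  obtain u where u: "u \<in> K" "y \<sim> u"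
    using symp_neighbour[OF \<xi> K(1,2) \<open>y \<in> \<xi>\<close>] by blast
  obtain v where v: "v \<in> M" "y \<sim> v"
    using symp_neighbour[OF \<xi> M(1,2) \<open>y \<in> \<xi>\<close>] by blast
  have "x \<noteq> u" "x \<noteq> v"
    using u v \<open>\<not> x \<sim> y\<close> adj_sym by blast+
  have adj: "u \<sim> x" "v \<sim> x"
    using line_collinear K M u v by metis+
  have "\<not> u \<sim> v"
  proof
    assume "u \<sim> v"
    then have "v \<in> K"
      using symp_two_neighbours[OF \<xi> K(1,2), of v x u] K M u v adj adj_sym \<open>x \<noteq> u\<close> by blast
    then have "y \<in> K" if "u \<noteq> v"
      using symp_two_neighbours[OF \<xi> K(1,2), of y u v] u v that \<open>y \<in> \<xi>\<close> by blast
    then have "u = v"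
      using line_collinear K \<open>\<not> x \<sim> y\<close> by metis
    \<comment> \<open>Lines with two common points are not yet known to be equal. Inside the
      symplecton they are, since each point of one has two neighbours on the other.\<close>
    have "z \<in> M" if "z \<in> K" for z
      using symp_two_neighbours[OF \<xi> M(1,2), of z x u] that K M u v \<open>u = v\<close> \<open>x \<noteq> u\<close> line_collinear[OF K(1)] by blast
    moreover have "z \<in> K" if "z \<in> M" for z
      using symp_two_neighbours[OF \<xi> K(1,2), of z x u] that K M u v \<open>u = v\<close> \<open>x \<noteq> u\<close> line_collinear[OF M(1)] by blast
    ultimately show False
      using \<open>M \<noteq> K\<close> by blast
  qed
  then show ?thesis
    using adj u v adj_sym by blast
qed

text \<open>If \<open>w\<close> is collinear with \<open>a\<close> on \<open>L\<close> but not with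
  \<open>b\<close> on \<open>L\<close>, then \<open>a\<close> is a common neighbour of
  \<open>w\<close> and \<open>b\<close>, and their symplecton contains \<open>L\<close>. So the
  critical case is that of two points of \<open>L\<close> with the same neighbours, all of
  \<open>L\<close> being far from \<open>z\<close>; here \<open>Imb\<close> gives the
  contradiction.\<close>

lemma line_in_symp:
  assumes L: "L \<in> lines \<Gamma>"
  shows "\<exists>\<xi>\<in>symps \<Gamma>. L \<subseteq> \<xi>"
proof -
  obtain x where x: "x \<in> L"
    using line_nonempty[OF L] by blast
  then have "x \<in> P"
    using line_points[OF L] by blast
  then obtain z where z: "z \<in> P" "\<not> z \<sim> x"
    using no_radical adj_sym by blast
  note \<zeta> = ex_symp[OF z(1) \<open>x \<in> P\<close> z(2)]
  consider "L = {x}" | y u where "y \<in> L" "x \<noteq> y" "u \<in> L" "z \<sim> u"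
    | y where "y \<in> L" "x \<noteq> y" "\<And>u. u \<in> L \<Longrightarrow> \<not> z \<sim> u"
    using x by blast
  then show ?thesis
  proof cases
    case 1
    then show ?thesis
      using \<zeta> by blast
  next
    case (2 y u)
    then have "u \<in> symp \<Gamma> z x"
      using symp_common_neighbour[OF \<zeta> z(2), of u] adj_sym line_collinear[OF L _ x] by blast
    moreover have "u \<noteq> x"
      using 2 z by blast
    ultimately show ?thesis
      using \<zeta>(1) symp_line[OF \<zeta>(1) L] x 2 \<zeta>(3) by blast
  next
    case (3 y)
    show ?thesis
    proof (cases "\<exists>w. w \<sim> x \<and> \<not> w \<sim> y \<or> w \<sim> y \<and> \<not> w \<sim> x")
      case True
      then obtain a b w where ab: "a \<in> {x, y}" "b \<in> {x, y}" "w \<sim> a" "\<not> w \<sim> b"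
        by blast
      then have "a \<in> L" "b \<in> L" "a \<noteq> b"
        using x 3(1) by blast+
      then have "b \<in> P" "w \<in> P"
        using line_points[OF L] adj_points ab by blast+
      note \<xi> = ex_symp[OF \<open>w \<in> P\<close> \<open>b \<in> P\<close> ab(4)]
      have "a \<in> symp \<Gamma> w b"
        using symp_common_neighbour[OF \<xi> ab(4)] ab(3) adj_sym line_collinear[OF L \<open>a \<in> L\<close> \<open>b \<in> L\<close>] by blast
      then show ?thesis
        using \<xi>(1) symp_line[OF \<xi>(1) L \<open>a \<in> L\<close> \<open>b \<in> L\<close> \<open>a \<noteq> b\<close>] \<xi>(3) by blast
    next
      case False
      text \<open>Then \<open>\<xi>(z,x) \<inter> \<xi>(z,y)\<close> contains all common neighbours of \<open>z\<close> and \<open>x\<close>, so it is not singular.\<close>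
      obtain u v where uv: "u \<sim> z" "u \<sim> x" "v \<sim> z" "v \<sim> x" "\<not> u \<sim> v"
        using symp_common_neighbours_not_clique[OF \<zeta> z(2)] by blast
      have "y \<in> P"
        using 3 line_points[OF L] by blast
      note \<eta> = ex_symp[OF z(1) \<open>y \<in> P\<close> 3(3)[OF 3(1)]]
      have "u \<in> symp \<Gamma> z x" "v \<in> symp \<Gamma> z x"
        using symp_common_neighbour[OF \<zeta> z(2)] uv by blast+
      moreover have "u \<in> symp \<Gamma> z y" "v \<in> symp \<Gamma> z y"
        using symp_common_neighbour[OF \<eta> 3(3)[OF 3(1)]] uv False by blast+
      ultimately have False
        using Imb(1)[OF z(1) L 3(3) x 3(1,2)] uv(5) unfolding singular_subspace_def by blast
      then show ?thesis ..
    qed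
  qed
qed

lemma line_at_least_three: "L \<in> lines \<Gamma> \<Longrightarrow> at_least_three L"
  using line_in_symp symp_line_at_least_three by metis

lemma line_other_point:
  assumes "L \<in> lines \<Gamma>"
  shows "\<exists>z\<in>L. z \<noteq> x \<and> z \<noteq> y"
  using at_least_three_other[OF line_at_least_three[OF assms]] by blast

text \<open>Inherited from a quadrangle: a symplecton through one of the lines contains the other,
  and every point of the latter has two neighbours on the former.\<close>

lemma line_unique:
  assumes "L \<in> lines \<Gamma>" "M \<in> lines \<Gamma>" "x \<in> L" "y \<in> L" "x \<in> M" "y \<in> M" "x \<noteq> y"
  shows "L = M"
proof -
  have "M' \<subseteq> L'"
    if L': "L' \<in> lines \<Gamma>" "x \<in> L'" "y \<in> L'" and M': "M' \<in> lines \<Gamma>" "x \<in> M'" "y \<in> M'" for L' M'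
  proof
    fix z
    assume "z \<in> M'"
    obtain \<xi> where \<xi>: "\<xi> \<in> symps \<Gamma>" "L' \<subseteq> \<xi>"
      using line_in_symp[OF L'(1)] by blast
    then have "z \<in> \<xi>"
      using symp_line[OF \<xi>(1) M' \<open>x \<noteq> y\<close>] L' \<open>z \<in> M'\<close> by blast
    moreover have "z \<sim> x" "z \<sim> y"
      using line_collinear M' \<open>z \<in> M'\<close> by metis+
    ultimately show "z \<in> L'"
      using symp_two_neighbours[OF \<xi>(1) L'(1) \<xi>(2)] L'(2,3) \<open>x \<noteq> y\<close> by blast
  qed
  then show ?thesis
    using assms by blast
qed

text \<open>Otherwise \<open>x\<close>, \<open>y\<close> and a line through them lie in the
  symplecton of \<open>u\<close> and \<open>v\<close>. Without triangles there, \<open>u\<close> and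
  \<open>v\<close> are on this line and so collinear after all. This is why two points determine a
  block.\<close>

lemma perp_pair_clique:
  assumes "x \<sim> y" "x \<noteq> y" "u \<in> perp \<Gamma> {x, y}" "v \<in> perp \<Gamma> {x, y}"
  shows "u \<sim> v"
proof (rule ccontr)
  assume "\<not> u \<sim> v"
  have uv: "u \<in> P" "v \<in> P" "u \<sim> x" "u \<sim> y" "v \<sim> x" "v \<sim> y"
    using assms unfolding perp_def by blast+
  note \<xi> = ex_symp[OF uv(1,2) \<open>\<not> u \<sim> v\<close>]
  obtain L where L: "L \<in> lines \<Gamma>" "x \<in> L" "y \<in> L"
    using collinear_line assms by metis
  have "x \<in> symp \<Gamma> u v" "y \<in> symp \<Gamma> u v"
    using symp_common_neighbour[OF \<xi> \<open>\<not> u \<sim> v\<close>] uv adj_sym by blast+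
  then have "L \<subseteq> symp \<Gamma> u v"
    using symp_line[OF \<xi>(1)] L \<open>x \<noteq> y\<close> by blast
  then have "u \<in> L" "v \<in> L"
    using symp_two_neighbours[OF \<xi>(1) L(1)] \<xi> L uv \<open>x \<noteq> y\<close> by blast+
  then show False
    using \<open>\<not> u \<sim> v\<close> line_collinear[OF L(1)] by blast
qed

section \<open>Maximal singular subspaces\<close>

abbreviation block :: "'a set \<Rightarrow> bool" where "block \<equiv> maximal_singular_subspace \<Gamma>"

lemma block_adj: "\<lbrakk>block B; x \<in> B; y \<in> B\<rbrakk> \<Longrightarrow> x \<sim> y"
  unfolding maximal_singular_subspace_def singular_subspace_def by blast

lemma block_subspace: "block B \<Longrightarrow> subspace \<Gamma> B"
  unfolding maximal_singular_subspace_def singular_subspace_def by blast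

lemma block_points: "block B \<Longrightarrow> B \<subseteq> P"
  using block_subspace unfolding subspace_def by blast

lemma block_line_subset: "\<lbrakk>block B; L \<in> lines \<Gamma>; x \<in> L; y \<in> L; x \<noteq> y; x \<in> B; y \<in> B\<rbrakk> \<Longrightarrow> L \<subseteq> B"
  using block_subspace unfolding subspace_def by blast

section \<open>Blocks as common neighbourhoods of two collinear points\<close>

lemma perp_pair_singular:
  assumes "x \<sim> y" "x \<noteq> y"
  shows "singular_subspace \<Gamma> (perp \<Gamma> {x, y})"
  using subspace_perp[OF plg one_or_all, of "{x, y}"] perp_pair_clique[OF assms] adj_points[OF assms(1)]
  unfolding singular_subspace_def by blast

lemma block_perp:
  assumes "x \<sim> y" "x \<noteq> y"
  shows "block (perp \<Gamma> {x, y})" and "x \<in> perp \<Gamma> {x, y}" and "y \<in> perp \<Gamma> {x, y}"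
proof -
  show mem: "x \<in> perp \<Gamma> {x, y}" "y \<in> perp \<Gamma> {x, y}"
    using assms adj_sym adj_refl adj_points[OF assms(1)] unfolding perp_def by blast+
  have "S = perp \<Gamma> {x, y}" if S: "singular_subspace \<Gamma> S" "perp \<Gamma> {x, y} \<subseteq> S" for S
  proof -
    have "S \<subseteq> P" "\<And>s t. \<lbrakk>s \<in> S; t \<in> S\<rbrakk> \<Longrightarrow> s \<sim> t"
      using S unfolding singular_subspace_def subspace_def by blast+
    then have "S \<subseteq> perp \<Gamma> {x, y}"
      using S(2) mem unfolding perp_def[of _ "{x, y}"] by blast
    then show ?thesis
      using S(2) by blast
  qed
  then show "block (perp \<Gamma> {x, y})"
    using perp_pair_singular[OF assms] unfolding maximal_singular_subspace_def by blast
qed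

lemma block_eq_perp:
  assumes "block B" "x \<in> B" "y \<in> B" "x \<noteq> y"
  shows "B = perp \<Gamma> {x, y}"
proof -
  have "B \<subseteq> perp \<Gamma> {x, y}"
    using block_adj[OF assms(1)] block_points[OF assms(1)] assms(2,3) unfolding perp_def by blast
  moreover have "singular_subspace \<Gamma> (perp \<Gamma> {x, y})"
    using perp_pair_singular block_adj[OF assms(1-3)] assms(4) by blast
  ultimately show ?thesis
    using assms(1) unfolding maximal_singular_subspace_def by blast
qed

lemma block_unique: "\<lbrakk>block A; block B; x \<in> A; y \<in> A; x \<in> B; y \<in> B; x \<noteq> y\<rbrakk> \<Longrightarrow> A = B"
  using block_eq_perp by metis

lemma block_two_neighbours:
  assumes "block B" "x \<in> B" "y \<in> B" "x \<noteq> y" "p \<sim> x" "p \<sim> y"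
  shows "p \<in> B"
  using block_eq_perp[OF assms(1-4)] assms(5,6) adj_points(1) unfolding perp_def by blast

lemma ex_symp_point:
  assumes "p \<in> P"
  shows "\<exists>\<xi>\<in>symps \<Gamma>. p \<in> \<xi>"
  using no_radical[OF assms] ex_symp[OF assms] by blast

lemma ex_neighbour:
  assumes "p \<in> P"
  shows "\<exists>q. p \<sim> q \<and> p \<noteq> q"
proof -
  obtain \<xi> where \<xi>: "\<xi> \<in> symps \<Gamma>" "p \<in> \<xi>"
    using ex_symp_point[OF assms] by blast
  then obtain L where "L \<in> lines \<Gamma>" "p \<in> L"
    using symp_ex_line by metis
  then show ?thesis
    using line_other_point[of L p p] line_collinear by metis
qed

text \<open>The empty set and single points are singular subspaces; they are not maximal because
  every point has a neighbour other than itself.\<close>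

lemma block_other_point:
  assumes "block B"
  shows "\<exists>x\<in>B. x \<noteq> y"
proof -
  have sing: "singular_subspace \<Gamma> B" and "\<And>S. \<lbrakk>singular_subspace \<Gamma> S; B \<subseteq> S\<rbrakk> \<Longrightarrow> S = B"
    using assms unfolding maximal_singular_subspace_def by blast+
  have "\<not> B \<subseteq> {y}"
  proof
    assume "B \<subseteq> {y}"
    then obtain p where p: "p \<in> P" "B \<subseteq> {p}"
      using ex_far_line block_points[OF assms] by blast
    then obtain q where q: "p \<sim> q" "p \<noteq> q"
      using ex_neighbour by blast
    then have "perp \<Gamma> {p, q} = B"
      using perp_pair_singular[OF q] block_perp(2)[OF q] p \<open>\<And>S. \<lbrakk>singular_subspace \<Gamma> S; B \<subseteq> S\<rbrakk> \<Longrightarrow> S = B\<close>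
      by blast
    then show False
      using block_perp[OF q] p q by blast
  qed
  then show ?thesis
    by blast
qed

lemma block_line:
  assumes "block B" "x \<in> B" "y \<in> B" "x \<noteq> y"
  shows "\<exists>L\<in>lines \<Gamma>. L \<subseteq> B \<and> x \<in> L \<and> y \<in> L"
  using collinear_line[OF block_adj[OF assms(1-3)] assms(4)] block_line_subset assms by metis

lemma ex_block_line:
  assumes "L \<in> lines \<Gamma>"
  shows "\<exists>B. block B \<and> L \<subseteq> B"
proof -
  obtain x where x: "x \<in> L"
    using line_nonempty[OF assms] by blast
  obtain y where y: "y \<in> L" "y \<noteq> x"
    using line_other_point[OF assms] by blast
  have "x \<sim> y"
    using line_collinear[OF assms x y(1)] .
  note B = block_perp[OF this y(2)[symmetric]]
  then show ?thesis
    using B(1) block_line_subset[OF B(1) assms x y(1) y(2)[symmetric]] by blast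
qed

text \<open>If \<open>p\<close> is far from a line of the block, \<open>Imb\<close> provides a line
  \<open>M\<close> through \<open>p\<close> in two symplecta. Neighbours on \<open>M\<close> of two
  points of the block complete a quadrangle, and its symplecton makes \<open>p\<close> collinear
  with a point of the block.\<close>

lemma block_neighbour:
  assumes B: "block B" and p: "p \<in> P"
  shows "\<exists>q\<in>B. p \<sim> q"
proof (rule ccontr)
  assume "\<not> ?thesis"
  then have far: "\<not> p \<sim> q" if "q \<in> B" for q
    using that by blast
  obtain y1 where y1: "y1 \<in> B"
    using block_other_point[OF B] by blast
  obtain y2 where y2: "y2 \<in> B" "y1 \<noteq> y2"
    using block_other_point[OF B] by blast
  obtain L where L: "L \<in> lines \<Gamma>" "L \<subseteq> B" "y1 \<in> L" "y2 \<in> L"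
    using block_line[OF B y1 y2] by blast
  let ?\<xi>1 = "symp \<Gamma> p y1" and ?\<xi>2 = "symp \<Gamma> p y2"
  have pts: "y1 \<in> P" "y2 \<in> P"
    using block_points[OF B] y1 y2 by blast+
  note \<xi>1 = ex_symp[OF p pts(1) far[OF y1]] and \<xi>2 = ex_symp[OF p pts(2) far[OF y2(1)]]
  let ?S = "?\<xi>1 \<inter> ?\<xi>2"
  have S: "singular_subspace \<Gamma> ?S" "maximal_singular_subspace (induced_geometry \<Gamma> ?\<xi>1) ?S"
    using Imb[OF p L(1) _ L(3,4) y2(2)] far L(2) by blast+
  obtain N where N: "N \<in> lines \<Gamma>" "N \<subseteq> ?\<xi>1" "p \<in> N"
    using symp_ex_line[OF \<xi>1(1,2)] by blast
  \<comment> \<open>A maximal singular subspace of a quadrangle cannot be as small as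
    \<open>{p}\<close>, since a line through \<open>p\<close> is singular and larger.\<close>
  have "N = ?S" if "?S \<subseteq> {p}"
  proof -
    have "singular_subspace (induced_geometry \<Gamma> ?\<xi>1) N"
      using polar_space_2_line[OF symp_polar_space[OF \<xi>1(1)]] N by (simp add: induced_line)
    then show ?thesis
      using S(2) that N(3) \<xi>1(2) unfolding maximal_singular_subspace_def by blast
  qed
  then have "\<not> ?S \<subseteq> {p}"
    using line_other_point[OF N(1), of p p] by blast
  then obtain q where q: "q \<in> ?S" "q \<noteq> p"
    by blast
  have "p \<sim> q"
    using S(1) q \<xi>1(2) \<xi>2(2) unfolding singular_subspace_def by blast
  then obtain M where M: "M \<in> lines \<Gamma>" "p \<in> M" "q \<in> M"
    using collinear_line q(2) by metis
  then have M_sub: "M \<subseteq> ?\<xi>1" "M \<subseteq> ?\<xi>2"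
    using symp_line[OF \<xi>1(1) M q(2)[symmetric]] symp_line[OF \<xi>2(1) M q(2)[symmetric]] q(1) \<xi>1(2) \<xi>2(2) by blast+
  obtain m1 where m1: "m1 \<in> M" "y1 \<sim> m1"
    using symp_neighbour[OF \<xi>1(1) M(1) M_sub(1) \<xi>1(3)] by blast
  obtain m2 where m2: "m2 \<in> M" "y2 \<sim> m2"
    using symp_neighbour[OF \<xi>2(1) M(1) M_sub(2) \<xi>2(3)] by blast
  have "m1 \<notin> B" "m2 \<notin> B"
    using far m1 m2 M line_collinear by metis+
  have "\<not> y1 \<sim> m2"
    using block_two_neighbours[OF B y1 y2(1,2)] m2 \<open>m2 \<notin> B\<close> adj_sym by blast
  then have "m1 \<noteq> m2"
    using m1 by blast
  have "m2 \<in> P"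
    using m2 adj_points by blast
  \<comment> \<open>The points \<open>y1\<close>, \<open>y2\<close>, \<open>m2\<close>,
    \<open>m1\<close> form a quadrangle with non-collinear opposite corners \<open>y1\<close> and
    \<open>m2\<close>; hence one symplecton contains both \<open>L\<close> and
    \<open>M\<close>.\<close>
  note \<xi> = ex_symp[OF pts(1) this \<open>\<not> y1 \<sim> m2\<close>]
  have "y2 \<in> symp \<Gamma> y1 m2" "m1 \<in> symp \<Gamma> y1 m2"
    using symp_common_neighbour[OF \<xi> \<open>\<not> y1 \<sim> m2\<close>] m1 m2 adj_sym block_adj[OF B y2(1) y1] line_collinear[OF M(1)]
    by blast+
  then have "L \<subseteq> symp \<Gamma> y1 m2" "p \<in> symp \<Gamma> y1 m2"
    using symp_line[OF \<xi>(1) L(1,3,4) y2(2)] symp_line[OF \<xi>(1) M(1) m1(1) m2(1) \<open>m1 \<noteq> m2\<close>] \<xi> M by blast+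
  then obtain q' where "q' \<in> L" "p \<sim> q'"
    using symp_neighbour[OF \<xi>(1) L(1)] by metis
  then show False
    using far L(2) by blast
qed

text \<open>A point \<open>x\<close> of \<open>\<xi>\<close> not collinear with \<open>p\<close> has
  a neighbour \<open>q\<close> in \<open>B\<close>. It is a common neighbour of \<open>x\<close> and
  \<open>p\<close>, so it lies in \<open>\<xi>\<close>, and the absence of triangles leaves nothing
  beyond the line through \<open>p\<close> and \<open>q\<close>.\<close>

lemma symp_inter_block:
  assumes B: "block B" and \<xi>: "\<xi> \<in> symps \<Gamma>" and p: "p \<in> B" "p \<in> \<xi>"
  shows "B \<inter> \<xi> \<in> lines \<Gamma>"
proof -
  obtain x where x: "x \<in> \<xi>" "\<not> p \<sim> x"
    using symp_not_adj[OF \<xi> p(2)] by blast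
  then have "x \<in> P"
    using symp_convex(3)[OF \<xi>] by blast
  then obtain q where q: "q \<in> B" "x \<sim> q"
    using block_neighbour[OF B] by blast
  have "q \<noteq> p"
    using q x adj_sym by blast
  have "q \<in> \<xi>"
    using symp_common_neighbour[OF \<xi> p(2) x] block_adj[OF B q(1) p(1)] q(2) adj_sym by blast
  obtain L where L: "L \<in> lines \<Gamma>" "L \<subseteq> B" "p \<in> L" "q \<in> L"
    using block_line[OF B p(1) q(1)] \<open>q \<noteq> p\<close> by blast
  then have "L \<subseteq> \<xi>"
    using symp_line[OF \<xi> L(1,3,4)] p \<open>q \<noteq> p\<close> \<open>q \<in> \<xi>\<close> by blast
  moreover have "z \<in> L" if "z \<in> B \<inter> \<xi>" for z
    using symp_two_neighbours[OF \<xi> L(1) \<open>L \<subseteq> \<xi>\<close> _ L(3,4)] block_adj[OF B] that p(1) q(1) \<open>q \<noteq> p\<close> by blast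
  ultimately have "B \<inter> \<xi> = L"
    using L(2) by blast
  then show ?thesis
    using L(1) by simp
qed

section \<open>Projection onto a maximal singular subspace\<close>

text \<open>Meaningful for a block \<open>B\<close> and \<open>p\<close> outside it: inside, every
  point of \<open>B\<close> would qualify and the description is not unique.\<close>

definition foot :: "'a set \<Rightarrow> 'a \<Rightarrow> 'a" where
  "foot B p = (THE q. q \<in> B \<and> p \<sim> q)"

lemma foot_eq:
  assumes "block B" "p \<notin> B" "q \<in> B" "p \<sim> q"
  shows "foot B p = q"
  unfolding foot_def
proof (rule the_equality)
  show "q \<in> B \<and> p \<sim> q"
    using assms by blast
  show "r = q" if "r \<in> B \<and> p \<sim> r" for r
    using that block_two_neighbours[OF assms(1), of r q p] assms(2-4) by blast
qed

lemma foot: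
  assumes "block B" "p \<in> P" "p \<notin> B"
  shows "foot B p \<in> B" and "p \<sim> foot B p"
proof -
  obtain q where "q \<in> B" "p \<sim> q"
    using block_neighbour[OF assms(1,2)] by blast
  moreover from this have "foot B p = q"
    using foot_eq[OF assms(1,3)] by blast
  ultimately show "foot B p \<in> B" "p \<sim> foot B p"
    by simp_all
qed

text \<open>A foot shared by two points of \<open>A\<close> would be collinear with both and hence
  belong to \<open>A\<close>.\<close>

lemma inj_on_foot:
  assumes "block A" "block B" "A \<inter> B = {}"
  shows "inj_on (foot B) A"
proof
  fix x y
  assume xy: "x \<in> A" "y \<in> A" "foot B x = foot B y"
  then have "x \<in> P" "y \<in> P" "x \<notin> B" "y \<notin> B"
    using assms block_points by blast+
  then have "foot B x \<sim> x" "foot B x \<sim> y" "foot B x \<in> B"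
    using foot[OF assms(2)] xy(3) adj_sym by metis+
  then show "x = y"
    using block_two_neighbours[OF assms(1) xy(1,2)] assms(3) by blast
qed

text \<open>The symplecton of one point of \<open>L\<close> and the foot of another contains
  \<open>L\<close> and meets \<open>B\<close> in a line. In this quadrangle, collinearity matches
  the points of the two lines, and the matching is \<open>foot B\<close>.\<close>

lemma foot_image_line:
  assumes A: "block A" and B: "block B" and disj: "A \<inter> B = {}" and L: "L \<in> lines \<Gamma>" "L \<subseteq> A"
  shows "foot B ` L \<in> lines \<Gamma>"
proof -
  obtain x where x: "x \<in> L"
    using line_nonempty[OF L(1)] by blast
  obtain y where y: "y \<in> L" "y \<noteq> x"
    using line_other_point[OF L(1)] by blast
  have pts: "z \<in> P" "z \<notin> B" if "z \<in> L" for z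
    using that line_points[OF L(1)] L(2) disj by blast+
  let ?x' = "foot B x" and ?y' = "foot B y"
  have x': "?x' \<in> B" "x \<sim> ?x'" and y': "?y' \<in> B" "y \<sim> ?y'"
    using foot[OF B pts[OF x]] foot[OF B pts[OF y(1)]] by blast+
  have "?x' \<noteq> ?y'"
    using inj_on_foot[OF A B disj] L(2) x y unfolding inj_on_def by blast
  then have "\<not> x \<sim> ?y'"
    using foot_eq[OF B pts(2)[OF x] y'(1)] by blast
  moreover have "?y' \<in> P"
    using y'(1) block_points[OF B] by blast
  ultimately obtain \<xi> where \<xi>: "\<xi> \<in> symps \<Gamma>" "x \<in> \<xi>" "?y' \<in> \<xi>"
    using ex_symp[OF pts(1)[OF x]] by blast
  have "y \<in> \<xi>"
    using symp_common_neighbour[OF \<xi> \<open>\<not> x \<sim> ?y'\<close>] line_collinear[OF L(1) y(1) x] y'(2) .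
  then have L_sub: "L \<subseteq> \<xi>"
    using symp_line[OF \<xi>(1) L(1) x y(1) y(2)[symmetric] \<xi>(2)] by blast
  have M: "B \<inter> \<xi> \<in> lines \<Gamma>"
    using symp_inter_block[OF B \<xi>(1) y'(1) \<xi>(3)] .
  have "foot B ` L \<subseteq> B \<inter> \<xi>"
  proof
    fix w
    assume "w \<in> foot B ` L"
    then obtain z where z: "z \<in> L" "w = foot B z"
      by blast
    then obtain q where "q \<in> B \<inter> \<xi>" "z \<sim> q"
      using symp_neighbour[OF \<xi>(1) M] L_sub by blast
    then show "w \<in> B \<inter> \<xi>"
      using foot_eq[OF B pts(2)[OF z(1)]] z(2) by blast
  qed
  moreover have "w \<in> foot B ` L" if w: "w \<in> B \<inter> \<xi>" for w
  proof -
    obtain z where z: "z \<in> L" "w \<sim> z"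
      using symp_neighbour[OF \<xi>(1) L(1) L_sub] w by blast
    then have "foot B z = w"
      using foot_eq[OF B pts(2)[OF z(1)]] w adj_sym by blast
    then show ?thesis
      using z(1) by blast
  qed
  ultimately have "foot B ` L = B \<inter> \<xi>"
    by blast
  then show ?thesis
    using M by simp
qed

text \<open>Blocks form no proper triangle: a common point of \<open>A\<close> and \<open>B\<close>
  is collinear with the two points \<open>y\<close> and \<open>z\<close> of \<open>D\<close>, so it
  lies in \<open>D\<close> and equals both.\<close>

lemma blocks_disjoint:
  assumes "block A" "block B" "block D" "A \<noteq> D" "B \<noteq> D"
    and "y \<in> A" "y \<in> D" "z \<in> B" "z \<in> D" "y \<noteq> z"
  shows "A \<inter> B = {}"
proof (rule ccontr)
  assume "A \<inter> B \<noteq> {}"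
  then obtain w where w: "w \<in> A" "w \<in> B"
    by blast
  then have "w \<in> D"
    using block_two_neighbours[OF assms(3,7,9,10)] block_adj assms by metis
  then have "w = y" "w = z"
    using block_unique[OF assms(1,3)] block_unique[OF assms(2,3)] w assms by metis+
  then show False
    using assms by blast
qed

text \<open>A point of \<open>A \<inter> \<xi>\<close> and one of \<open>B \<inter> \<xi>\<close>
  have the common neighbour \<open>z\<close> outside \<open>\<xi>\<close>, so they are collinear.
  Without triangles the two lines then coincide, and the blocks share two points.\<close>

lemma symp_blocks_eq:
  assumes \<xi>: "\<xi> \<in> symps \<Gamma>" and A: "block A" "A \<inter> \<xi> \<noteq> {}" and B: "block B" "B \<inter> \<xi> \<noteq> {}"
    and z: "z \<in> A" "z \<in> B" "z \<notin> \<xi>"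
  shows "A = B"
proof -
  have L: "A \<inter> \<xi> \<in> lines \<Gamma>"
    using symp_inter_block[OF A(1) \<xi>] A(2) by blast
  have M: "B \<inter> \<xi> \<in> lines \<Gamma>"
    using symp_inter_block[OF B(1) \<xi>] B(2) by blast
  obtain x where x: "x \<in> A \<inter> \<xi>"
    using A(2) by blast
  obtain y where y: "y \<in> A \<inter> \<xi>" "y \<noteq> x"
    using line_other_point[OF L] by blast
  have "w \<in> A \<inter> \<xi>" if w: "w \<in> B \<inter> \<xi>" for w
  proof -
    have "w \<sim> u" if "u \<in> A \<inter> \<xi>" for u
      using symp_common_neighbour[OF \<xi>, of w u z] block_adj[OF A(1) z(1)] block_adj[OF B(1) z(2)] that w z(3)
      by blast
    then show ?thesis
      using symp_two_neighbours[OF \<xi> L _ _ x y(1) y(2)[symmetric]] x y(1) w by blast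
  qed
  moreover obtain u where "u \<in> B \<inter> \<xi>"
    using B(2) by blast
  moreover obtain v where "v \<in> B \<inter> \<xi>" "v \<noteq> u"
    using line_other_point[OF M] by blast
  ultimately show ?thesis
    using block_unique[OF A(1) B(1), of u v] by blast
qed

text \<open>Thickness enters here: three lines of a symplecton through \<open>p\<close> lie in
  distinct blocks, since a block meets the symplecton in just one line.\<close>

lemma ex_third_block:
  assumes "p \<in> P"
  shows "\<exists>D. block D \<and> p \<in> D \<and> D \<noteq> A \<and> D \<noteq> B"
proof -
  obtain \<xi> where \<xi>: "\<xi> \<in> symps \<Gamma>" "p \<in> \<xi>"
    using ex_symp_point[OF assms] by blast
  obtain L where L: "L \<in> lines \<Gamma>" "L \<subseteq> \<xi>" "p \<in> L" "L \<noteq> A \<inter> \<xi>" "L \<noteq> B \<inter> \<xi>"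
    using at_least_three_other[OF symp_lines_at_least_three[OF \<xi>], of "A \<inter> \<xi>" "B \<inter> \<xi>"] by blast
  obtain D where D: "block D" "L \<subseteq> D"
    using ex_block_line[OF L(1)] by blast
  have M: "D \<inter> \<xi> \<in> lines \<Gamma>"
    using symp_inter_block[OF D(1) \<xi>(1)] \<xi>(2) L(3) D(2) by blast
  obtain q where "q \<in> L" "q \<noteq> p"
    using line_other_point[OF L(1)] by blast
  then have "L = D \<inter> \<xi>"
    using line_unique[OF L(1) M, of p q] L D(2) by blast
  then show ?thesis
    using D L by blast
qed

text \<open>A block through a far line is larger than this line, because every point has a neighbour
  in the block. Disjoint blocks are isomorphic by taking feet, so the property spreads to them; for
  blocks that meet, a third block disjoint from both mediates.\<close>

lemma block_not_line:
  assumes A: "block A"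
  shows "A \<notin> lines \<Gamma>"
proof
  assume A_line: "A \<in> lines \<Gamma>"
  obtain x L where far: "x \<in> P" "L \<in> lines \<Gamma>" "\<And>y. y \<in> L \<Longrightarrow> \<not> x \<sim> y"
    using ex_far_line by blast
  obtain B where B: "block B" "L \<subseteq> B"
    using ex_block_line[OF far(2)] by blast
  have disj: "D \<notin> lines \<Gamma>" if D: "block D" "D' \<notin> lines \<Gamma>" "block D'" "D' \<inter> D = {}" for D D'
  proof
    assume D_line: "D \<in> lines \<Gamma>"
    have "D' = foot D' ` D"
    proof
      show "foot D' ` D \<subseteq> D'"
        using foot(1)[OF D(3)] block_points[OF D(1)] D(4) by blast
      show "D' \<subseteq> foot D' ` D"
      proof
        fix w
        assume w: "w \<in> D'"
        then have "w \<in> P" "w \<notin> D"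
          using block_points[OF D(3)] D(4) by blast+
        then have "foot D w \<in> D" "foot D w \<sim> w"
          using foot[OF D(1)] adj_sym by blast+
        then have "foot D' (foot D w) = w"
          using foot_eq[OF D(3) _ w] D(4) by blast
        then show "w \<in> foot D' ` D"
          using \<open>foot D w \<in> D\<close> by force
      qed
    qed
    then show False
      using foot_image_line[OF D(1,3) _ D_line] D(2,4) by (simp add: Int_commute)
  qed
  have B_line: "B \<notin> lines \<Gamma>"
  proof
    assume "B \<in> lines \<Gamma>"
    obtain u where "u \<in> L"
      using line_nonempty[OF far(2)] by blast
    moreover obtain v where "v \<in> L" "v \<noteq> u"
      using line_other_point[OF far(2)] by blast
    ultimately have "B = L"
      using line_unique[OF \<open>B \<in> lines \<Gamma>\<close> far(2)] B(2) by blast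
    then show False
      using block_neighbour[OF B(1) far(1)] far(3) by blast
  qed
  show False
  proof (cases "A \<inter> B = {}")
    case True
    then show ?thesis
      using disj[OF A B_line B(1)] A_line by blast
  next
    case False
    then obtain p where p: "p \<in> A" "p \<in> B"
      by blast
    then have "p \<in> P"
      using block_points[OF A] by blast
    then obtain D where D: "block D" "p \<in> D" "D \<noteq> A" "D \<noteq> B"
      using ex_third_block by metis
    obtain x where x: "x \<in> D" "x \<noteq> p"
      using block_other_point[OF D(1)] by blast
    then obtain E where E: "block E" "x \<in> E" "E \<noteq> D"
      using ex_third_block[of x D D] block_points[OF D(1)] by blast
    have "E \<inter> A = {}" "E \<inter> B = {}"
      using blocks_disjoint[OF E(1) _ D(1) E(3) _ E(2) x(1) _ D(2) x(2)] A B(1) D(3,4) p by metis+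
    then have "E \<notin> lines \<Gamma>"
      using disj[OF E(1) B_line B(1)] by (simp add: Int_commute)
    then show ?thesis
      using disj[OF A _ E(1)] \<open>E \<inter> A = {}\<close> A_line by blast
  qed
qed

lemma block_line_avoiding:
  assumes B: "block B" and y: "y \<in> B"
  shows "\<exists>L\<in>lines \<Gamma>. L \<subseteq> B \<and> y \<notin> L"
proof -
  obtain x where x: "x \<in> B" "x \<noteq> y"
    using block_other_point[OF B] by blast
  obtain M where M: "M \<in> lines \<Gamma>" "M \<subseteq> B" "y \<in> M" "x \<in> M"
    using block_line[OF B y x(1)] x(2) by blast
  then have "B \<noteq> M"
    using block_not_line[OF B] by metis
  then obtain z where z: "z \<in> B" "z \<notin> M"
    using M(2) by blast
  have "x \<noteq> z"
    using M(4) z(2) by metis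
  then obtain L where L: "L \<in> lines \<Gamma>" "L \<subseteq> B" "x \<in> L" "z \<in> L"
    using block_line[OF B x(1) z(1)] by metis
  then have "y \<notin> L"
    using line_unique[OF L(1) M(1), of x y] M x(2) z(2) by blast
  then show ?thesis
    using L by blast
qed

text \<open>The block through \<open>K\<close> must miss \<open>B\<close>: a common point would be
  the foot of every point of \<open>K\<close>, whereas \<open>k\<close> and \<open>k'\<close> have
  different feet.\<close>

lemma foot_image_transversal:
  assumes B: "block B" and K: "K \<in> lines \<Gamma>" "k \<in> K" "k' \<in> K" "K \<inter> B = {}" "foot B k \<noteq> foot B k'"
  shows "foot B ` K \<in> lines \<Gamma>"
proof -
  obtain D where D: "block D" "K \<subseteq> D"
    using ex_block_line[OF K(1)] by blast
  have "m \<notin> D" if "m \<in> B" for m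
  proof
    assume "m \<in> D"
    then have "k \<sim> m" "k' \<sim> m"
      using block_adj[OF D(1)] D(2) K(2,3) by blast+
    then have "foot B k = m" "foot B k' = m"
      using foot_eq[OF B] that K(2-4) by blast+
    then show False
      using K(5) by simp
  qed
  then show ?thesis
    using foot_image_line[OF D(1) B _ K(1) D(2)] by blast
qed

section \<open>Fibres of the projection of a symplecton\<close>

definition fibre :: "'a set \<Rightarrow> 'a set \<Rightarrow> 'a \<Rightarrow> 'a set" where
  "fibre \<xi> B n = {z \<in> \<xi>. foot B z = n}"

text \<open>Two points of \<open>\<xi>\<close> with the common foot \<open>n\<close> are collinear,
  for otherwise \<open>n\<close> would lie in \<open>\<xi>\<close>. So a nonempty fibre is the trace
  on \<open>\<xi>\<close> of the block through \<open>n\<close> and one of its points.\<close>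

lemma fibre_eq_inter:
  assumes \<xi>: "\<xi> \<in> symps \<Gamma>" and B: "block B" "\<xi> \<inter> B = {}" and p: "p \<in> fibre \<xi> B n"
  shows "fibre \<xi> B n = perp \<Gamma> {n, p} \<inter> \<xi>" and "n \<sim> p" "n \<noteq> p" "n \<in> B"
proof -
  have p': "p \<in> P" "p \<in> \<xi>" "p \<notin> B" "foot B p = n"
    using p symp_convex(3)[OF \<xi>] B(2) unfolding fibre_def by blast+
  then show n: "n \<sim> p" "n \<in> B"
    using foot[OF B(1)] adj_sym by blast+
  then show "n \<noteq> p"
    using p' by blast
  have "z \<in> fibre \<xi> B n \<longleftrightarrow> z \<in> perp \<Gamma> {n, p}" if "z \<in> \<xi>" for z
  proof
    have z: "z \<in> P" "z \<notin> B"
      using that symp_convex(3)[OF \<xi>] B(2) by blast+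
    assume "z \<in> fibre \<xi> B n"
    then have "z \<sim> n"
      using foot[OF B(1) z] unfolding fibre_def by blast
    moreover have "z \<sim> p"
      using symp_common_neighbour[OF \<xi> that p'(2), of n] n(1) \<open>z \<sim> n\<close> adj_sym n(2) B(2) by blast
    ultimately show "z \<in> perp \<Gamma> {n, p}"
      using z(1) unfolding perp_def by blast
  next
    assume "z \<in> perp \<Gamma> {n, p}"
    then have "z \<sim> n"
      unfolding perp_def by blast
    then show "z \<in> fibre \<xi> B n"
      using foot_eq[OF B(1) _ n(2)] that B(2) unfolding fibre_def by blast
  qed
  then show "fibre \<xi> B n = perp \<Gamma> {n, p} \<inter> \<xi>"
    unfolding fibre_def by blast
qed

lemma fibre_line:
  assumes "\<xi> \<in> symps \<Gamma>" "block B" "\<xi> \<inter> B = {}" "p \<in> fibre \<xi> B n"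
  shows "fibre \<xi> B n \<in> lines \<Gamma>"
proof -
  note * = fibre_eq_inter[OF assms]
  show ?thesis
    unfolding *(1)
    by (rule symp_inter_block[OF block_perp(1)[OF *(2,3)] assms(1) block_perp(3)[OF *(2,3)]])
      (use assms(4) in \<open>simp add: fibre_def\<close>)
qed

text \<open>The block containing the fibre meets \<open>D\<close> in \<open>n\<close>, while
  \<open>B\<close> meets \<open>D\<close> in \<open>y\<close>. As blocks form no proper triangle, it
  is disjoint from \<open>B\<close>, and taking feet in \<open>B\<close> is faithful on it.\<close>

lemma foot_image_fibre:
  assumes \<xi>: "\<xi> \<in> symps \<Gamma>" and B: "block B" "\<xi> \<inter> B = {}" and D: "block D" "\<xi> \<inter> D = {}"
    and "B \<noteq> D" "y \<in> B" "y \<in> D" "n \<noteq> y" and p: "p \<in> fibre \<xi> D n"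
  shows "foot B ` fibre \<xi> D n \<in> lines \<Gamma>" and "inj_on (foot B) (fibre \<xi> D n)"
proof -
  note * = fibre_eq_inter[OF \<xi> D p]
  note E = block_perp[OF *(2,3)]
  have "p \<notin> D"
    using p D(2) unfolding fibre_def by blast
  then have "perp \<Gamma> {n, p} \<noteq> D"
    using E(3) by metis
  then have disj: "perp \<Gamma> {n, p} \<inter> B = {}"
    using blocks_disjoint[OF E(1) B(1) D(1) _ \<open>B \<noteq> D\<close> E(2) *(4) \<open>y \<in> B\<close> \<open>y \<in> D\<close> \<open>n \<noteq> y\<close>] by blast
  show "foot B ` fibre \<xi> D n \<in> lines \<Gamma>"
    using foot_image_line[OF E(1) B(1) disj fibre_line[OF \<xi> D p]] *(1) by blast
  show "inj_on (foot B) (fibre \<xi> D n)"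
    using inj_on_foot[OF E(1) B(1) disj] *(1) by (auto intro: inj_on_subset)
qed

section \<open>The configuration inside a block\<close>

lemma block_configuration:
  assumes B: "block B"
  shows "\<exists>N1 N2 K1 K2 y. {N1, N2, K1, K2} \<subseteq> lines \<Gamma> \<and> N1 \<union> N2 \<union> K1 \<union> K2 \<subseteq> B \<and> N1 \<inter> N2 = {} \<and> K1 \<noteq> K2 \<and>
    y \<in> K1 \<and> y \<in> K2 \<and> y \<notin> N1 \<and> y \<notin> N2 \<and>
    N1 \<inter> K1 \<noteq> {} \<and> N1 \<inter> K2 \<noteq> {} \<and> N2 \<inter> K1 \<noteq> {} \<and> N2 \<inter> K2 \<noteq> {}"
proof -
  obtain y where y: "y \<in> B" "y \<in> P"
    using block_other_point[OF B] block_points[OF B] by blast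
  obtain A where A: "block A" "y \<in> A" "A \<noteq> B"
    using ex_third_block[OF y(2)] by blast
  obtain D where D: "block D" "y \<in> D" "D \<noteq> B" "D \<noteq> A"
    using ex_third_block[OF y(2)] by blast
  obtain L where L: "L \<in> lines \<Gamma>" "L \<subseteq> A" "y \<notin> L"
    using block_line_avoiding[OF A(1,2)] by blast
  obtain \<xi> where \<xi>: "\<xi> \<in> symps \<Gamma>" "L \<subseteq> \<xi>"
    using line_in_symp[OF L(1)] by blast
  obtain l where l: "l \<in> L"
    using line_nonempty[OF L(1)] by blast
  obtain l' where l': "l' \<in> L" "l' \<noteq> l"
    using line_other_point[OF L(1)] by blast
  \<comment> \<open>Otherwise the line \<open>A \<inter> \<xi>\<close> would contain
    \<open>y\<close> and all of \<open>L\<close>, hence be \<open>L\<close>, which avoids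
    \<open>y\<close>.\<close>
  have "y \<notin> \<xi>"
  proof
    assume "y \<in> \<xi>"
    then have "A \<inter> \<xi> \<in> lines \<Gamma>" "y \<in> A \<inter> \<xi>"
      using symp_inter_block[OF A(1) \<xi>(1) A(2)] A(2) by blast+
    then show False
      using line_unique[of "A \<inter> \<xi>" L l l'] l l' L \<xi>(2) by blast
  qed
  \<comment> \<open>Through \<open>y\<close>, a point outside \<open>\<xi>\<close>, at most one
    block meets \<open>\<xi>\<close>; \<open>A\<close> does so along \<open>L\<close>.\<close>
  then have B_disj: "\<xi> \<inter> B = {}" and D_disj: "\<xi> \<inter> D = {}"
    using symp_blocks_eq[OF \<xi>(1) A(1) _ B] symp_blocks_eq[OF \<xi>(1) A(1) _ D(1)] A(2,3) D(2,4) y(1) l L(2) \<xi>(2)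
    by blast+
  have \<xi>_pts: "\<xi> \<subseteq> P"
    using symp_convex(3)[OF \<xi>(1)] .
  \<comment> \<open>The points of \<open>L\<close> are collinear with \<open>y\<close> inside
    \<open>A\<close>, so \<open>y\<close> is their foot; the fibre over \<open>y\<close>, being a
    line, is no larger. This applies to \<open>B\<close> and \<open>D\<close> alike.\<close>
  have fibre_y: "fibre \<xi> E y = L" if E: "block E" "y \<in> E" "\<xi> \<inter> E = {}" for E
  proof -
    have sub: "L \<subseteq> fibre \<xi> E y"
      using foot_eq[OF E(1) _ E(2)] block_adj[OF A(1) _ A(2)] E(3) L(2) \<xi>(2) unfolding fibre_def by blast
    then have "fibre \<xi> E y \<in> lines \<Gamma>"
      using fibre_line[OF \<xi>(1) E(1,3)] l by blast
    then show ?thesis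
      using line_unique[OF _ L(1), of "fibre \<xi> E y" l l'] sub l l' by blast
  qed
  have foot_y: "z \<in> L" if "z \<in> \<xi>" "foot E z = y" "block E" "y \<in> E" "\<xi> \<inter> E = {}" for E z
    using fibre_y[OF that(3-5)] that(1,2) unfolding fibre_def by blast
  have foot_L: "foot E z = y" if "z \<in> L" "block E" "y \<in> E" "\<xi> \<inter> E = {}" for E z
    using fibre_y[OF that(2-4)] that(1) unfolding fibre_def by blast
  obtain x where x: "x \<in> \<xi>" "x \<notin> L"
    using symp_not_adj[OF \<xi>(1)] l \<xi>(2) line_collinear[OF L(1) l] by blast
  define y' where "y' = foot D x"
  define T where "T = fibre \<xi> D y'"
  have "x \<in> T"
    using x unfolding T_def fibre_def y'_def by simp
  have y': "y' \<noteq> y" "y' \<in> D"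
    using foot_y[OF x(1) _ D(1,2) D_disj] x(2) fibre_eq_inter(4)[OF \<xi>(1) D(1) D_disj] \<open>x \<in> T\<close>
    unfolding y'_def T_def by blast+
  have T: "T \<in> lines \<Gamma>" "T \<subseteq> \<xi>"
    using fibre_line[OF \<xi>(1) D(1) D_disj] \<open>x \<in> T\<close> unfolding T_def fibre_def by blast+
  have LT: "t \<notin> L" if "t \<in> T" for t
    using that foot_L[OF _ D(1,2) D_disj] y'(1) unfolding T_def fibre_def by blast
  obtain R where R: "R \<in> lines \<Gamma>" "R \<subseteq> D" "y \<in> R" "y' \<in> R"
    using block_line[OF D(1,2) y'(2)] y'(1) by metis
  obtain n where n: "n \<in> R" "n \<noteq> y" "n \<noteq> y'"
    using line_other_point[OF R(1)] by blast
  define S where "S = fibre \<xi> D n"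
  have LS: "s \<notin> L" if "s \<in> S" for s
    using that foot_L[OF _ D(1,2) D_disj] n(2) unfolding S_def fibre_def by blast
  have TS: "s \<notin> T" if "s \<in> S" for s
    using that n(3) unfolding S_def T_def fibre_def by blast
  text \<open>The feet in \<open>D\<close> of a transversal of \<open>L\<close> and \<open>T\<close> form the line \<open>R\<close> through \<open>y\<close>, \<open>y'\<close> and \<open>n\<close>;
    therefore the transversal meets the fibre \<open>S\<close> of \<open>n\<close>, too.\<close>
  have transversal: "\<exists>K\<in>lines \<Gamma>. \<exists>k\<in>L. \<exists>s\<in>S. k \<in> K \<and> t \<in> K \<and> s \<in> K \<and> K \<subseteq> \<xi>" if t: "t \<in> T" for t
  proof -
    obtain k where k: "k \<in> L" "t \<sim> k"
      using symp_neighbour[OF \<xi>(1) L(1) \<xi>(2)] t T(2) by blast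
    then have "k \<noteq> t"
      using LT[OF t] by blast
    then obtain K where K: "K \<in> lines \<Gamma>" "t \<in> K" "k \<in> K"
      using collinear_line[OF k(2)] by blast
    then have K_sub: "K \<subseteq> \<xi>"
      using symp_line[OF \<xi>(1) K(1,2,3)] k(1) \<xi>(2) T(2) t \<open>k \<noteq> t\<close> by blast
    have feet: "foot D k = y" "foot D t = y'"
      using foot_L[OF k(1) D(1,2) D_disj] t unfolding T_def fibre_def by blast+
    then have "foot D ` K \<in> lines \<Gamma>"
      using foot_image_transversal[OF D(1) K(1,3,2)] K_sub D_disj y'(1) by auto
    moreover have "y \<in> foot D ` K" "y' \<in> foot D ` K"
      using feet K(2,3) by blast+
    ultimately have "foot D ` K = R"
      using line_unique[OF _ R(1)] R(3,4) y'(1) by metis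
    then obtain s where "s \<in> K" "foot D s = n"
      using n(1) by blast
    then show ?thesis
      using K k(1) K_sub unfolding S_def fibre_def by blast
  qed
  obtain s0 where s0: "s0 \<in> S"
    using transversal[OF \<open>x \<in> T\<close>] by blast
  have S: "S \<in> lines \<Gamma>" "S \<subseteq> \<xi>"
    using fibre_line[OF \<xi>(1) D(1) D_disj] s0 unfolding S_def fibre_def by blast+
  have foot_B: "foot B z \<in> B" if "z \<in> \<xi>" for z
    using foot(1)[OF B] that \<xi>_pts B_disj by blast
  have image_K: "foot B ` K \<in> lines \<Gamma>" "y \<in> foot B ` K"
    if "K \<in> lines \<Gamma>" "k \<in> L" "k \<in> K" "t \<in> K" "t \<in> T" "K \<subseteq> \<xi>" for K k t
  proof -
    have "foot B k = y" "foot B t \<noteq> y"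
      using foot_L[OF that(2) B y(1) B_disj] foot_y[OF _ _ B y(1) B_disj] LT[OF that(5)] that(4,6) by blast+
    then show "foot B ` K \<in> lines \<Gamma>" "y \<in> foot B ` K"
      using foot_image_transversal[OF B that(1,3,4)] that(3,6) B_disj by auto
  qed
  define N1 where "N1 = foot B ` T"
  define N2 where "N2 = foot B ` S"
  have N1: "N1 \<in> lines \<Gamma>" and inj_T: "inj_on (foot B) T"
    using foot_image_fibre[OF \<xi>(1) B B_disj D(1) D_disj D(3)[symmetric] y(1) D(2) y'(1)] \<open>x \<in> T\<close>
    unfolding N1_def T_def by blast+
  have N2: "N2 \<in> lines \<Gamma>"
    using foot_image_fibre(1)[OF \<xi>(1) B B_disj D(1) D_disj D(3)[symmetric] y(1) D(2) n(2)] s0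
    unfolding N2_def S_def by blast
  have yN: "y \<notin> N1" "y \<notin> N2"
    using foot_y[OF _ _ B y(1) B_disj] LT LS T(2) S(2) unfolding N1_def N2_def by blast+
  have N_disj: "N1 \<inter> N2 = {}"
  proof (rule ccontr)
    assume "N1 \<inter> N2 \<noteq> {}"
    then obtain t s where ts: "t \<in> T" "s \<in> S" "foot B t = foot B s"
      unfolding N1_def N2_def by fast
    let ?F = "fibre \<xi> B (foot B t)"
    have F: "?F \<in> lines \<Gamma>" "t \<in> ?F" "s \<in> ?F"
      using fibre_line[OF \<xi>(1) B B_disj, of t] ts T(2) S(2) unfolding fibre_def by auto
    obtain K k s' where K: "K \<in> lines \<Gamma>" "k \<in> L" "s' \<in> S" "k \<in> K" "t \<in> K" "s' \<in> K" "K \<subseteq> \<xi>"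
      using transversal[OF ts(1)] by blast
    have "t \<notin> S"
      using TS ts(1) by blast
    \<comment> \<open>Both are neighbours of \<open>t\<close> on \<open>S\<close>, one along the
      fibre and one along the transversal.\<close>
    then have "s' = s"
      using symp_two_neighbours[OF \<xi>(1) S(1,2), of t s s'] T(2) ts K line_collinear[OF F(1,2,3)]
        line_collinear[OF K(1,5,6)] by blast
    then have "?F = K"
      using line_unique[OF F(1) K(1), of t s] F K ts(2) \<open>t \<notin> S\<close> by blast
    then have "foot B k = foot B t"
      using K(4) unfolding fibre_def by blast
    then have "foot B t = y"
      using foot_L[OF K(2) B y(1) B_disj] by simp
    then show False
      using yN(1) ts(1) unfolding N1_def by blast
  qed
  obtain t where t: "t \<in> T" "t \<noteq> x"
    using line_other_point[OF T(1)] by blast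
  obtain K1 k1 s1 where K1: "K1 \<in> lines \<Gamma>" "k1 \<in> L" "s1 \<in> S" "k1 \<in> K1" "x \<in> K1" "s1 \<in> K1" "K1 \<subseteq> \<xi>"
    using transversal[OF \<open>x \<in> T\<close>] by blast
  obtain K2 k2 s2 where K2: "K2 \<in> lines \<Gamma>" "k2 \<in> L" "s2 \<in> S" "k2 \<in> K2" "t \<in> K2" "s2 \<in> K2" "K2 \<subseteq> \<xi>"
    using transversal[OF t(1)] by blast
  note I1 = image_K[OF K1(1,2,4,5) \<open>x \<in> T\<close> K1(7)] and I2 = image_K[OF K2(1,2,4,5) t(1) K2(7)]
  \<comment> \<open>If the images agreed, they would share the distinct feet of \<open>x\<close> and
    \<open>t\<close> with \<open>N1\<close> and so equal \<open>N1\<close>, which avoids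
    \<open>y\<close>.\<close>
  have "foot B ` K1 \<noteq> foot B ` K2"
  proof
    assume eq: "foot B ` K1 = foot B ` K2"
    have "foot B x \<noteq> foot B t"
      using inj_T t \<open>x \<in> T\<close> unfolding inj_on_def by blast
    moreover have "foot B x \<in> foot B ` K1" "foot B t \<in> foot B ` K1"
      using eq K1(5) K2(5) by blast+
    moreover have "foot B x \<in> N1" "foot B t \<in> N1"
      using \<open>x \<in> T\<close> t(1) unfolding N1_def by blast+
    ultimately have "foot B ` K1 = N1"
      using line_unique[OF I1(1) N1] by blast
    then show False
      using I1(2) yN(1) by blast
  qed
  moreover have "N1 \<inter> foot B ` K1 \<noteq> {}" "N1 \<inter> foot B ` K2 \<noteq> {}" "N2 \<inter> foot B ` K1 \<noteq> {}" "N2 \<inter> foot B ` K2 \<noteq> {}"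
    using \<open>x \<in> T\<close> t(1) K1(3,5,6) K2(3,5,6) unfolding N1_def N2_def by blast+
  moreover have "N1 \<union> N2 \<union> foot B ` K1 \<union> foot B ` K2 \<subseteq> B"
    using foot_B T(2) S(2) K1(7) K2(7) unfolding N1_def N2_def by blast
  moreover have "{N1, N2, foot B ` K1, foot B ` K2} \<subseteq> lines \<Gamma>"
    using N1 N2 I1(1) I2(1) by blast
  ultimately show ?thesis
    using N_disj yN I1(2) I2(2)
    by - (rule exI[of _ N1], rule exI[of _ N2], rule exI[of _ "foot B ` K1"],
        rule exI[of _ "foot B ` K2"], rule exI[of _ y], intro conjI)
qed

lemma block_ONan:
  assumes B: "block B"
  shows "\<exists>Q. non_closing_ONan_configuration (induced_geometry \<Gamma> B) Q"
    and "\<not> projective_space (induced_geometry \<Gamma> B)"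
proof -
  obtain N1 N2 K1 K2 y where lines: "{N1, N2, K1, K2} \<subseteq> lines \<Gamma>" and sub: "N1 \<union> N2 \<union> K1 \<union> K2 \<subseteq> B"
    and disj: "N1 \<inter> N2 = {}" and y: "K1 \<noteq> K2" "y \<in> K1" "y \<in> K2" "y \<notin> N1" "y \<notin> N2"
    and meet: "N1 \<inter> K1 \<noteq> {}" "N1 \<inter> K2 \<noteq> {}" "N2 \<inter> K1 \<noteq> {}" "N2 \<inter> K2 \<noteq> {}"
    using block_configuration[OF B] by metis
  obtain a b c d where abcd: "a \<in> N1 \<inter> K1" "b \<in> N1 \<inter> K2" "c \<in> N2 \<inter> K1" "d \<in> N2 \<inter> K2"
    using meet by blast
  have neq: "N1 \<noteq> K1" "N1 \<noteq> K2" "N2 \<noteq> K1" "N2 \<noteq> K2" "N1 \<noteq> N2"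
    using y disj abcd by blast+
  have inter: "M \<inter> N = {p}" if "{M, N} \<subseteq> lines \<Gamma>" "M \<noteq> N" "p \<in> M" "p \<in> N" for M N p
    using line_unique[of M N p] that by blast
  have sing: "N1 \<inter> K1 = {a}" "N1 \<inter> K2 = {b}" "N2 \<inter> K1 = {c}" "N2 \<inter> K2 = {d}" "K1 \<inter> K2 = {y}"
    using inter neq lines abcd y by simp_all
  have dist: "distinct [a, b, c, d, y]"
    using sing y disj abcd by auto
  have lines': "{N1, N2, K1, K2} \<subseteq> lines (induced_geometry \<Gamma> B)"
    using lines sub by (simp add: induced_geometry_def)
  have "non_closing_ONan_configuration (induced_geometry \<Gamma> B) {N1, N2, K1, K2}"
    unfolding non_closing_ONan_configuration_def
    by (rule conjI[OF lines'], rule exI[of _ N1], rule exI[of _ N2], rule exI[of _ K1], rule exI[of _ K2],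
        rule exI[of _ a], rule exI[of _ b], rule exI[of _ c], rule exI[of _ d], rule exI[of _ y],
        intro conjI refl sing disj dist) (use neq y(1) in simp)
  then show "\<exists>Q. non_closing_ONan_configuration (induced_geometry \<Gamma> B) Q"
    by blast
  have pts: "{a, c, b, d} \<subseteq> points (induced_geometry \<Gamma> B)" "distinct [a, c, b, d]"
    using abcd sub dist by (auto simp: induced_points)
  show "\<not> projective_space (induced_geometry \<Gamma> B)"
  proof
    assume "projective_space (induced_geometry \<Gamma> B)"
    then have "\<forall>a b c d AB CD AC BD.
      {a, b, c, d} \<subseteq> points (induced_geometry \<Gamma> B) \<and> distinct [a, b, c, d] \<and>
      {AB, CD, AC, BD} \<subseteq> lines (induced_geometry \<Gamma> B) \<and>
      {a, b} \<subseteq> AB \<and> {c, d} \<subseteq> CD \<and> {a, c} \<subseteq> AC \<and> {b, d} \<subseteq> BD \<and>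
      AB \<inter> CD \<noteq> {} \<longrightarrow> AC \<inter> BD \<noteq> {}"
      unfolding projective_space_def by (elim conjE)
    \<comment> \<open>The order of the points makes \<open>K1\<close> and \<open>K2\<close>, which
      meet in \<open>y\<close>, the premise of the axiom and the disjoint lines \<open>N1\<close>
      and \<open>N2\<close> its conclusion.\<close>
    note this[rule_format, of a c b d K1 K2 N1 N2]
    moreover have "K1 \<inter> K2 \<noteq> {}" "{a, c} \<subseteq> K1" "{b, d} \<subseteq> K2" "{a, b} \<subseteq> N1" "{c, d} \<subseteq> N2"
      using abcd y by blast+
    moreover have "{K1, K2, N1, N2} \<subseteq> lines (induced_geometry \<Gamma> B)"
      using lines' by blast
    ultimately show False
      using pts disj by blast
  qed
qed

end

theorem theorem3p7:
  fixes \<Gamma> :: "'a geometry"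
  assumes "imbrex_geometry \<Gamma>"
    and "has_symplectic_rank \<Gamma> 2"
    and "\<forall>\<xi>\<in>symps \<Gamma>. thick_generalized_quadrangle (induced_geometry \<Gamma> \<xi>)"
  shows "(\<forall>B. maximal_singular_subspace \<Gamma> B \<longrightarrow>
            (\<exists>Q. non_closing_ONan_configuration (induced_geometry \<Gamma> B) Q)) \<and>
         (\<forall>B. maximal_singular_subspace \<Gamma> B \<longrightarrow>
            \<not> projective_space (induced_geometry \<Gamma> B))"
proof -
  interpret thick_imbrex \<Gamma>
    using assms(1,3) by (intro thick_imbrex.intro) simp_all
  show ?thesis
    using block_ONan by blast
qed

end
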